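(* Let $L$ be a $\mathcal L_1$-space, let $X$ and $Y$ be Banach spaces, and let $0 \to Y \to L \to X \to 0$ be an exact sequence of Banach spaces and bounded linear operators. If $X$ has the BAP, then $Y$ has the BAP.
   Context: A Banach space $X$ has the $\lambda$-BAP ($\lambda\ge 1$) if for each finite dimensional subspace $F\subset X$ there is a finite rank bounded operator $T:X\to X$ with $\|T\|\le \lambda$ and $T(f)=f$ for each $f\in F$. $X$ has the BAP (Bounded Approximation Property) if it has the $\lambda$-BAP for some $\lambda$. A Banach space $L$ is a $\mathcal L_1$-space if there is $\mu\ge 1$ such that every finite dimensional subspace of $L$ is contained in a finite dimensional subspace $G$ of $L$ whose Banach–Mazur distance to $\ell_1^{\dim G}$ is at most $\mu$. An exact sequence $0\to Y\to X\to Z\to 0$ of Banach spaces is a diagram of bounded linear operators in which the kernel of each arrow coincides with the image of the preceding one. *)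

theory Defs
  imports "HOL-Analysis.Analysis" "HOL-Analysis.Finite_Function_Topology"
begin

definition finite_dim :: "'a::real_vector set \<Rightarrow> bool" where
  "finite_dim S \<longleftrightarrow> (\<exists>B. finite B \<and> S = span B)"

definition has_lambda_BAP :: "real \<Rightarrow> 'a::banach itself \<Rightarrow> bool" where
  "has_lambda_BAP l (X :: 'a itself) \<longleftrightarrow>
     (\<forall>F::'a set. finite_dim F \<longrightarrow>
       (\<exists>T::'a \<Rightarrow> 'a. bounded_linear T \<and> finite_dim (range T) \<and>
          onorm T \<le> l \<and> (\<forall>f\<in>F. T f = f)))"

definition has_BAP :: "'a::banach itself \<Rightarrow> bool" where
  "has_BAP X \<longleftrightarrow> (\<exists>l\<ge>1. has_lambda_BAP l X)"

(* The norm that Finite_Function_Topology puts on finitely supported functions is the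
   sum of the norms of the values, so the vectors supported in {..<n} form ell_1^n. *)
definition ell1 :: "nat \<Rightarrow> (nat \<Rightarrow>\<^sub>0 real) set" where
  "ell1 n = {x. Poly_Mapping.keys x \<subseteq> {..<n}}"

lemma norm_ell1:
  assumes "x \<in> ell1 n"
  shows "norm x = (\<Sum>i<n. \<bar>Poly_Mapping.lookup x i\<bar>)"
proof -
  have "norm x = (\<Sum>i\<in>Poly_Mapping.keys x. \<bar>Poly_Mapping.lookup x i\<bar>)"
    by (simp add: norm_poly_mapping_def dist_poly_mapping_def)
  also have "\<dots> = (\<Sum>i<n. \<bar>Poly_Mapping.lookup x i\<bar>)"
    by (rule sum.mono_neutral_left) (use assms in \<open>auto simp: ell1_def in_keys_iff\<close>)
  finally show ?thesis .
qed

definition linear_bij_betw ::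
    "('a::real_vector \<Rightarrow> 'b::real_vector) \<Rightarrow> 'a set \<Rightarrow> 'b set \<Rightarrow> bool" where
  "linear_bij_betw f S T \<longleftrightarrow> bij_betw f S T \<and>
     (\<forall>x\<in>S. \<forall>y\<in>S. f (x + y) = f x + f y) \<and> (\<forall>c. \<forall>x\<in>S. f (c *\<^sub>R x) = c *\<^sub>R f x)"

(* The operator norm of the restriction of f to the subspace S, infinite if that restriction
   is unbounded. As for onorm, the vector 0 contributes 0 / 0 = 0. *)
definition onorm_on ::
    "'a::real_normed_vector set \<Rightarrow> ('a \<Rightarrow> 'b::real_normed_vector) \<Rightarrow> ereal" where
  "onorm_on S f = (SUP x\<in>S. ereal (norm (f x) / norm x))"

(* The multiplicative Banach-Mazur distance of two subspaces. A linear bijection that is not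
   an isomorphism of normed spaces contributes the value infinity, and the distance of
   spaces that are not isomorphic is infinity. *)
definition banach_mazur_dist ::
    "'a::real_normed_vector set \<Rightarrow> 'b::real_normed_vector set \<Rightarrow> ereal" where
  "banach_mazur_dist S T =
     (INF f\<in>{f. linear_bij_betw f S T}. onorm_on S f * onorm_on T (inv_into S f))"

definition is_L1_space :: "'a::banach itself \<Rightarrow> bool" where
  "is_L1_space (L :: 'a itself) \<longleftrightarrow>
     (\<exists>\<mu>\<ge>1. \<forall>F::'a set. finite_dim F \<longrightarrow>
        (\<exists>G::'a set. finite_dim G \<and> F \<subseteq> G \<and> banach_mazur_dist G (ell1 (dim G)) \<le> ereal \<mu>))"

(* Exactness of 0 \<rightarrow> Y \<rightarrow> E \<rightarrow> X \<rightarrow> 0 at Y, E and X, in this order. *)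
definition short_exact_sequence ::
    "('y::banach \<Rightarrow> 'e::banach) \<Rightarrow> ('e \<Rightarrow> 'x::banach) \<Rightarrow> bool" where
  "short_exact_sequence j q \<longleftrightarrow> bounded_linear j \<and> bounded_linear q \<and>
     {y. j y = 0} = {0} \<and> {e. q e = 0} = range j \<and> range q = UNIV"

end

theory Submission
  imports Defs
begin

text \<open>Let \<open>q\<close> be the quotient map of \<open>L\<close> onto \<open>X\<close>, and regard \<open>Y\<close> as its kernel. Two
  properties of \<open>L\<close> do the work.

  \<^item> \<open>L\<close> has the bounded approximation property
    (\<open>uniform_finite_rank_extension_of_identity\<close>).
  \<^item> A finite-rank operator \<open>V\<close> from \<open>L\<close> to \<open>X\<close> is \<open>q \<circ> W\<close> for a finite-rank operator \<open>W\<close>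
    on \<open>L\<close> whose norm is at most a constant times that of \<open>V\<close> (\<open>finite_rank_lifting\<close>).

  Given a finite-dimensional \<open>E \<subseteq> Y\<close>, take a finite-rank \<open>P\<close> on \<open>L\<close> that is the identity on
  \<open>E\<close>, then a finite-rank \<open>S\<close> on \<open>X\<close> that is the identity on the image of \<open>q \<circ> P\<close>, then a
  finite-rank \<open>W\<close> with \<open>q \<circ> W = S \<circ> q\<close>, all with bounds that do not depend on \<open>E\<close>. Put
  \<open>T = P + W (1 - P)\<close>. It has finite rank and fixes \<open>E\<close> because \<open>P\<close> does. It maps \<open>Y\<close> to
  \<open>Y\<close>: for \<open>y \<in> Y\<close>, as \<open>q y = 0\<close> and \<open>S\<close> fixes \<open>q (P y)\<close>,
  \<open>q (T y) = q (P y) + S (q y) - S (q (P y)) = 0\<close>.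

  Both properties come from one construction. On a finite-dimensional \<open>\<ell>\<^sub>1\<close>, an operator may be
  prescribed freely on the unit vectors, and its norm is the largest of their image norms; up to
  a constant, the same holds on arbitrarily large finite-dimensional subspaces of \<open>L\<close>. If the
  target is a fixed finite-dimensional \<open>\<ell>\<^sub>1\<close>, operators on larger and larger subspaces have a
  limit on all of \<open>L\<close>, by
  Tychonoff's theorem (\<open>coordinate_limit\<close>). For the lifting, the target is spanned by finitely
  many atoms in the image of \<open>V\<close> (\<open>finite_dim_atoms\<close>), which are lifted through \<open>q\<close> one by
  one. For the approximation property, the unit vectors are merged into finitely many groups,
  each consisting of those on which the coordinates of a basis of \<open>E\<close> are nearly proportional
  (\<open>approximate_identity\<close>).\<close>

section \<open>Finite-dimensional subspaces and finite-rank operators\<close>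

lemma finite_dim_subspace:
  assumes "subspace S" "finite B" "S \<subseteq> span B"
  shows "finite_dim S"
proof -
  obtain B' where B': "B' \<subseteq> S" "independent B'" "S \<subseteq> span B'"
    using maximal_independent_subset by blast
  have "finite B'"
    using independent_span_bound[OF assms(2) B'(2)] B'(1) assms(3) by blast
  moreover have "S = span B'"
    using B' assms(1) by (simp add: span_minimal subset_antisym)
  ultimately show ?thesis unfolding finite_dim_def by blast
qed

lemma finite_dim_basis:
  assumes "finite_dim S"
  obtains B where "finite B" "independent B" "S = span B"
proof -
  obtain A where A: "finite A" "S = span A" using assms unfolding finite_dim_def by blast
  obtain B where B: "B \<subseteq> S" "independent B" "S \<subseteq> span B"
    using maximal_independent_subset by blast
  have "finite B" using independent_span_bound[OF A(1) B(2)] B(1) A(2) by blast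
  moreover have "S = span B" using B A by (simp add: span_minimal subset_antisym)
  ultimately show thesis using that B(2) by blast
qed

lemma finite_dim_linear_image:
  assumes "linear f" "finite_dim S"
  shows "finite_dim (f ` S)"
proof -
  obtain B where "finite B" "S = span B" using assms(2) unfolding finite_dim_def by blast
  then have "f ` S = span (f ` B)" using linear_span_image[OF assms(1)] by simp
  with \<open>finite B\<close> show ?thesis unfolding finite_dim_def by blast
qed

text \<open>Approximants of the identity, projections and liftings are all obtained as such sums of rank-one
  operators.\<close>

lemma finite_rank_sum:
  fixes s :: "'c \<Rightarrow> 'a::real_normed_vector \<Rightarrow> real" and l :: "'c \<Rightarrow> 'b::real_normed_vector"
  assumes "finite C" and s: "\<And>c. c \<in> C \<Longrightarrow> bounded_linear (s c)"
  shows "bounded_linear (\<lambda>x. \<Sum>c\<in>C. s c x *\<^sub>R l c)"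
    and "finite_dim (range (\<lambda>x. \<Sum>c\<in>C. s c x *\<^sub>R l c))"
proof -
  show bl: "bounded_linear (\<lambda>x. \<Sum>c\<in>C. s c x *\<^sub>R l c)"
    using s by (intro bounded_linear_sum bounded_linear_compose[OF bounded_linear_scaleR_left])
  show "finite_dim (range (\<lambda>x. \<Sum>c\<in>C. s c x *\<^sub>R l c))"
  proof (rule finite_dim_subspace)
    show "subspace (range (\<lambda>x. \<Sum>c\<in>C. s c x *\<^sub>R l c))"
      using bl by (intro linear_subspace_image subspace_UNIV) (simp add: bounded_linear.linear)
    show "finite (l ` C)" using assms(1) by simp
    show "range (\<lambda>x. \<Sum>c\<in>C. s c x *\<^sub>R l c) \<subseteq> span (l ` C)"
      by (intro image_subsetI span_sum span_scale) (simp add: span_base)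
  qed
qed

lemma norm_sum_scaleR_le:
  fixes l :: "'c \<Rightarrow> 'b::real_normed_vector"
  assumes "\<And>c. c \<in> C \<Longrightarrow> norm (l c) \<le> M"
  shows "norm (\<Sum>c\<in>C. a c *\<^sub>R l c) \<le> (\<Sum>c\<in>C. \<bar>a c\<bar>) * M"
proof -
  have "norm (\<Sum>c\<in>C. a c *\<^sub>R l c) \<le> (\<Sum>c\<in>C. \<bar>a c\<bar> * M)"
    by (rule sum_norm_le) (use assms in \<open>simp add: mult_left_mono\<close>)
  then show ?thesis by (simp add: sum_distrib_right)
qed

lemma deviation_on_span:
  assumes B: "finite B" and P: "bounded_linear P"
    and K: "\<And>c. (\<Sum>b\<in>B. \<bar>c b\<bar>) \<le> K * norm (\<Sum>b\<in>B. c b *\<^sub>R b)"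
    and dev: "\<And>f. f \<in> B \<Longrightarrow> norm (f - P f) \<le> \<delta>" and \<delta>: "0 \<le> \<delta>" and x: "x \<in> span B"
  shows "norm (x - P x) \<le> \<delta> * K * norm x"
proof -
  interpret P: bounded_linear P by (rule P)
  obtain a where a: "x = (\<Sum>f\<in>B. a f *\<^sub>R f)" using x unfolding span_finite[OF B] by blast
  have "x - P x = (\<Sum>f\<in>B. a f *\<^sub>R (f - P f))"
    by (simp add: a P.sum P.scaleR scaleR_diff_right sum_subtractf)
  also have "norm \<dots> \<le> (\<Sum>f\<in>B. \<bar>a f\<bar>) * \<delta>" by (rule norm_sum_scaleR_le) (rule dev)
  also have "\<dots> \<le> (K * norm x) * \<delta>" using K[of a] \<delta> by (simp add: a mult_right_mono)
  finally show ?thesis by (simp add: mult_ac)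
qed

text \<open>The operator \<open>T = U + V (1 - U)\<close> satisfies \<open>1 - T = (1 - V) (1 - U)\<close>: it fixes whatever \<open>U\<close>
  fixes, while on other vectors \<open>V\<close> acts on what \<open>U\<close> has left over. It serves once to turn an
  approximate identity on a subspace into an exact one, and once to turn an operator on the
  middle term of the exact sequence into one that preserves the kernel.\<close>

lemma finite_rank_combine:
  fixes U V :: "'a::real_normed_vector \<Rightarrow> 'a"
  assumes U: "bounded_linear U" "finite_dim (range U)" and V: "bounded_linear V" "finite_dim (range V)"
  shows "bounded_linear (\<lambda>x. U x + V (x - U x))" "finite_dim (range (\<lambda>x. U x + V (x - U x)))"
proof -
  show bl: "bounded_linear (\<lambda>x. U x + V (x - U x))"
    by (intro bounded_linear_add U bounded_linear_compose[OF V(1)] bounded_linear_sub bounded_linear_ident)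
  obtain A where A: "finite A" "range U = span A" using U(2) unfolding finite_dim_def by blast
  obtain B where B: "finite B" "range V = span B" using V(2) unfolding finite_dim_def by blast
  show "finite_dim (range (\<lambda>x. U x + V (x - U x)))"
  proof (rule finite_dim_subspace)
    show "subspace (range (\<lambda>x. U x + V (x - U x)))"
      using bl by (intro linear_subspace_image subspace_UNIV) (simp add: bounded_linear.linear)
    show "finite (A \<union> B)" using A B by simp
    have "U x \<in> span (A \<union> B)" "V x \<in> span (A \<union> B)" for x
      using A(2) B(2) span_mono[of A "A \<union> B"] span_mono[of B "A \<union> B"] by blast+
    then show "range (\<lambda>x. U x + V (x - U x)) \<subseteq> span (A \<union> B)"
      by (intro image_subsetI span_add)
  qed
qed

text \<open>The norm attains a minimum on the coefficient vectors of \<open>\<ell>\<^sub>1\<close>-norm one, as they form a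
  compact set, and the minimum is positive because \<open>B\<close> is independent.\<close>

lemma coefficients_bounded_by_norm:
  fixes B :: "'a::real_normed_vector set"
  assumes fin: "finite B" and ind: "independent B"
  obtains K where "K > 0" "\<And>c. (\<Sum>b\<in>B. \<bar>c b\<bar>) \<le> K * norm (\<Sum>b\<in>B. c b *\<^sub>R b)"
proof (cases "B = {}")
  case True
  then show thesis using that[of 1] by simp
next
  case False
  \<comment> \<open>Coefficients outside \<open>B\<close> are set to zero, which makes the set compact in the product topology on all functions.\<close>
  define S :: "('a \<Rightarrow> real) set"
    where "S = (\<Pi>\<^sub>E b\<in>UNIV. if b \<in> B then {-1..1} else {0}) \<inter> {c. (\<Sum>b\<in>B. \<bar>c b\<bar>) = 1}"
  have "compactin (product_topology (\<lambda>_::'a. euclidean :: real topology) UNIV)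
          (\<Pi>\<^sub>E b\<in>UNIV. if b \<in> B then {-1..1} else {0})"
    unfolding compactin_PiE by (simp add: compactin_euclidean_iff)
  then have "compact (\<Pi>\<^sub>E b\<in>(UNIV::'a set). if b \<in> B then {-1..1::real} else {0})"
    unfolding euclidean_product_topology by simp
  moreover have "closed {c::'a \<Rightarrow> real. (\<Sum>b\<in>B. \<bar>c b\<bar>) = 1}"
    by (intro closed_Collect_eq continuous_intros continuous_on_product_coordinates)
  ultimately have "compact S" unfolding S_def by (rule compact_Int_closed)
  moreover from False obtain b where b: "b \<in> B" by blast
  have "(\<lambda>x. if x = b then 1 else 0) \<in> S"
    using b fin by (auto simp: S_def if_distrib cong: if_cong)
  then have "S \<noteq> {}" by blast
  moreover have "continuous_on S (\<lambda>c. norm (\<Sum>b\<in>B. c b *\<^sub>R b))"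
    by (intro continuous_intros continuous_on_subset[OF continuous_on_product_coordinates]) simp
  ultimately obtain c0 where c0: "c0 \<in> S"
      "\<And>c. c \<in> S \<Longrightarrow> norm (\<Sum>b\<in>B. c0 b *\<^sub>R b) \<le> norm (\<Sum>b\<in>B. c b *\<^sub>R b)"
    by (meson continuous_attains_inf)
  define m where "m = norm (\<Sum>b\<in>B. c0 b *\<^sub>R b)"
  have "m \<noteq> 0"
  proof
    assume "m = 0"
    then have "(\<Sum>b\<in>B. c0 b *\<^sub>R b) = 0" by (simp add: m_def)
    then have "c0 b = 0" if "b \<in> B" for b
      using independentD[OF ind fin subset_refl] that by blast
    then show False using c0(1) by (simp add: S_def)
  qed
  then have m: "m > 0" by (simp add: m_def)
  have "(\<Sum>b\<in>B. \<bar>c b\<bar>) \<le> 1 / m * norm (\<Sum>b\<in>B. c b *\<^sub>R b)" for c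
  proof (cases "(\<Sum>b\<in>B. \<bar>c b\<bar>) = 0")
    case False
    define s where "s = (\<Sum>b\<in>B. \<bar>c b\<bar>)"
    have s: "s > 0" using False by (simp add: s_def order_less_le sum_nonneg)
    define d where "d b = (if b \<in> B then c b / s else 0)" for b
    have "\<bar>c b\<bar> \<le> s" if "b \<in> B" for b
      unfolding s_def by (rule member_le_sum) (use that fin in auto)
    then have d1: "\<bar>d b\<bar> \<le> 1" if "b \<in> B" for b using that s by (simp add: d_def)
    have "(\<Sum>b\<in>B. \<bar>d b\<bar>) = 1"
      using s by (simp add: d_def flip: sum_divide_distrib s_def)
    moreover have "d b \<in> (if b \<in> B then {-1..1} else {0})" for b
    proof (cases "b \<in> B")
      case True
      with d1[OF True] show ?thesis by (simp only: abs_le_iff) auto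
    qed (simp add: d_def)
    ultimately have "d \<in> S" unfolding S_def by blast
    then have "m \<le> norm (\<Sum>b\<in>B. d b *\<^sub>R b)" using c0(2) by (simp add: m_def)
    also have "(\<Sum>b\<in>B. d b *\<^sub>R b) = (1 / s) *\<^sub>R (\<Sum>b\<in>B. c b *\<^sub>R b)"
      by (simp add: d_def scaleR_sum_right)
    finally show ?thesis using s m by (simp add: s_def[symmetric] field_simps)
  qed (use m in simp)
  then show thesis using that[of "1 / m"] m by simp
qed

text \<open>The unit ball is contained in twice the absolutely convex hull of finitely many vectors of norm
  at most two. Rounding the coefficients of a unit vector with respect to \<open>B\<close> down to a grid
  leaves a grid point, of norm at most two, and a small nonnegative combination of \<open>B\<close>. So the
  grid points and the normalized basis vectors serve as atoms, and represent \<open>x\<close> exactly.\<close>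

lemma finite_dim_atoms:
  fixes B :: "'a::real_normed_vector set"
  assumes B: "finite B" "independent B"
  obtains C t where "finite C" "\<And>c. c \<in> C \<Longrightarrow> norm c \<le> 2"
    "\<And>x. x \<in> span B \<Longrightarrow> (\<Sum>c\<in>C. t x c *\<^sub>R c) = x" "\<And>x. x \<in> span B \<Longrightarrow> (\<Sum>c\<in>C. \<bar>t x c\<bar>) \<le> 2 * norm x"
proof -
  obtain K where K: "K > 0" "\<And>c. (\<Sum>b\<in>B. \<bar>c b\<bar>) \<le> K * norm (\<Sum>b\<in>B. c b *\<^sub>R b)"
    using coefficients_bounded_by_norm[OF B] by metis
  define N where "N = (\<Sum>b\<in>B. norm b)"
  have N: "N \<ge> 0" by (simp add: N_def sum_nonneg)
  \<comment> \<open>The mesh is so fine that the remainder has norm at most one.\<close>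
  define h where "h = 1 / (N + 1)"
  have h: "h > 0" "h * N \<le> 1" using N by (auto simp: h_def)
  define m where "m = \<lceil>K / h\<rceil> + 1"
  define Z where "Z = {z. \<forall>b. (b \<in> B \<longrightarrow> z b \<in> {-m..m}) \<and> (b \<notin> B \<longrightarrow> z b = (0::int))}"
  have Z: "finite Z" unfolding Z_def by (rule finite_set_of_finite_funs) (use B in auto)
  define p where "p z = (\<Sum>b\<in>B. (h * real_of_int (z b)) *\<^sub>R b)" for z
  define C where "C = {c \<in> p ` Z. norm c \<le> 2} \<union> sgn ` B"
  have C: "finite C" using Z B(1) by (simp add: C_def)
  have C2: "norm c \<le> 2" if "c \<in> C" for c
    using that by (auto simp: C_def norm_sgn)
  have unit: "\<exists>t. (\<Sum>c\<in>C. t c *\<^sub>R c) = x \<and> (\<Sum>c\<in>C. \<bar>t c\<bar>) \<le> 2" if x: "x \<in> span B" "norm x = 1" for x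
  proof -
    obtain a where a: "x = (\<Sum>b\<in>B. a b *\<^sub>R b)" using x(1) unfolding span_finite[OF B(1)] by blast
    have aK: "\<bar>a b\<bar> \<le> K" if "b \<in> B" for b
    proof -
      have "\<bar>a b\<bar> \<le> (\<Sum>b\<in>B. \<bar>a b\<bar>)" by (rule member_le_sum) (use that B in auto)
      also have "\<dots> \<le> K" using K(2)[of a] x(2) by (simp add: a)
      finally show ?thesis .
    qed
    define z where "z b = (if b \<in> B then \<lfloor>a b / h\<rfloor> else 0)" for b
    have "z b \<in> {-m..m}" if b: "b \<in> B" for b
    proof -
      have "\<bar>a b / h\<bar> \<le> K / h" using aK[OF b] h by (simp add: divide_right_mono)
      then have "- (K / h) \<le> a b / h" "a b / h \<le> K / h" by (simp_all only: abs_le_iff) auto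
      moreover have "K / h \<le> real_of_int m" unfolding m_def by linarith
      ultimately have "real_of_int (- m) \<le> a b / h" "a b / h < real_of_int m + 1" by linarith+
      then have "- m \<le> \<lfloor>a b / h\<rfloor>" "\<lfloor>a b / h\<rfloor> \<le> m"
        by (simp_all only: le_floor_iff floor_le_iff)
      then show ?thesis using b by (simp add: z_def)
    qed
    then have zZ: "z \<in> Z" by (simp add: Z_def z_def)
    define r where "r b = a b - h * real_of_int (z b)" for b
    have r: "0 \<le> r b" "r b \<le> h" if "b \<in> B" for b
    proof -
      have "real_of_int (z b) \<le> a b / h" "a b / h \<le> real_of_int (z b) + 1"
        using that by (simp_all add: z_def)
      then show "0 \<le> r b" "r b \<le> h" using h(1) by (simp_all add: r_def field_simps)
    qed
    have xr: "x = p z + (\<Sum>b\<in>B. r b *\<^sub>R b)"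
      by (simp add: a p_def r_def scaleR_diff_left sum_subtractf)
    have rN: "(\<Sum>b\<in>B. r b * norm b) \<le> 1"
    proof -
      have "(\<Sum>b\<in>B. r b * norm b) \<le> (\<Sum>b\<in>B. h * norm b)"
        using r by (intro sum_mono mult_right_mono) auto
      then show ?thesis using h(2) by (simp add: N_def sum_distrib_left)
    qed
    have "norm (\<Sum>b\<in>B. r b *\<^sub>R b) \<le> (\<Sum>b\<in>B. r b * norm b)"
      by (rule sum_norm_le) (use r in simp)
    then have "norm (p z) \<le> 2"
      using norm_triangle_ineq4[of x "\<Sum>b\<in>B. r b *\<^sub>R b"] x(2) rN by (simp add: xr)
    then have pC: "p z \<in> C" using zZ by (simp add: C_def)
    \<comment> \<open>The indicators add up coefficients that belong to the same vector, for distinct basis vectors, or the grid point and a basis vector, may give the same atom.\<close>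
    define t where "t c = of_bool (c = p z) + (\<Sum>b\<in>B. of_bool (c = sgn b) * (r b * norm b))" for c
    have t0: "t c \<ge> 0" for c unfolding t_def using r by (intro add_nonneg_nonneg sum_nonneg) auto
    have collect: "(\<Sum>c\<in>C. t c *\<^sub>R F c) = F (p z) + (\<Sum>b\<in>B. (r b * norm b) *\<^sub>R F (sgn b))"
      for F :: "'a \<Rightarrow> 'c::real_vector"
    proof -
      have "(\<Sum>c\<in>C. t c *\<^sub>R F c) = (\<Sum>c\<in>C. of_bool (c = p z) *\<^sub>R F c) +
          (\<Sum>b\<in>B. \<Sum>c\<in>C. (of_bool (c = sgn b) * (r b * norm b)) *\<^sub>R F c)"
        unfolding t_def scaleR_add_left sum.distrib scaleR_sum_left
        by (subst sum.swap) (rule refl)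
      also have "(\<Sum>c\<in>C. of_bool (c = p z) *\<^sub>R F c) = (\<Sum>c\<in>C. if c = p z then F c else 0)"
        by (rule sum.cong) auto
      also have "\<dots> = F (p z)" using pC C by simp
      also have "(\<Sum>b\<in>B. \<Sum>c\<in>C. (of_bool (c = sgn b) * (r b * norm b)) *\<^sub>R F c) =
          (\<Sum>b\<in>B. (r b * norm b) *\<^sub>R F (sgn b))"
      proof (rule sum.cong[OF refl])
        fix b assume b: "b \<in> B"
        have "(\<Sum>c\<in>C. (of_bool (c = sgn b) * (r b * norm b)) *\<^sub>R F c) =
            (\<Sum>c\<in>C. if c = sgn b then (r b * norm b) *\<^sub>R F c else 0)"
          by (rule sum.cong) auto
        also have "\<dots> = (r b * norm b) *\<^sub>R F (sgn b)" using b C by (simp add: C_def)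
        finally show "(\<Sum>c\<in>C. (of_bool (c = sgn b) * (r b * norm b)) *\<^sub>R F c) =
            (r b * norm b) *\<^sub>R F (sgn b)" .
      qed
      finally show ?thesis .
    qed
    have "norm b *\<^sub>R sgn b = b" for b :: 'a by (cases "b = 0") (simp_all add: sgn_div_norm)
    then have "(\<Sum>c\<in>C. t c *\<^sub>R c) = x"
      using collect[of "\<lambda>c. c"] by (simp add: xr flip: scaleR_scaleR)
    moreover have "(\<Sum>c\<in>C. \<bar>t c\<bar>) \<le> 2"
      using collect[of "\<lambda>_. 1::real"] t0 rN by simp
    ultimately show ?thesis by blast
  qed
  have "\<exists>t. (\<Sum>c\<in>C. t c *\<^sub>R c) = x \<and> (\<Sum>c\<in>C. \<bar>t c\<bar>) \<le> 2 * norm x" if x: "x \<in> span B" for x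
  proof (cases "x = 0")
    case True
    then show ?thesis by (intro exI[of _ "\<lambda>_. 0"]) simp
  next
    case False
    then obtain t where t: "(\<Sum>c\<in>C. t c *\<^sub>R c) = sgn x" "(\<Sum>c\<in>C. \<bar>t c\<bar>) \<le> 2"
      using unit[of "sgn x"] x by (auto simp: sgn_div_norm span_scale)
    show ?thesis
    proof (intro exI conjI)
      have "(\<Sum>c\<in>C. (norm x * t c) *\<^sub>R c) = norm x *\<^sub>R sgn x"
        by (simp add: scaleR_sum_right flip: t(1))
      then show "(\<Sum>c\<in>C. (norm x * t c) *\<^sub>R c) = x" using False by (simp add: sgn_div_norm)
      show "(\<Sum>c\<in>C. \<bar>norm x * t c\<bar>) \<le> 2 * norm x"
        using mult_left_mono[OF t(2) norm_ge_zero[of x]]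
        by (simp add: abs_mult sum_distrib_left mult.commute)
    qed
  qed
  then obtain t where t: "\<And>x. x \<in> span B \<Longrightarrow> (\<Sum>c\<in>C. t x c *\<^sub>R c) = x \<and> (\<Sum>c\<in>C. \<bar>t x c\<bar>) \<le> 2 * norm x"
    by metis
  show thesis by (rule that[OF C C2, of t]) (use t in auto)
qed

section \<open>The open mapping theorem\<close>

text \<open>By the Baire category theorem in the complete space \<open>range f\<close>, the closure of the image of
  some ball contains a ball of \<open>range f\<close>. Differences of its points approximate every vector of
  the range within half of its norm by images of vectors of comparable norm, and iterating the
  approximation on the remainders gives an exact preimage as a geometrically dominated series.\<close>

lemma open_mapping_closed_range:
  fixes f :: "'a::banach \<Rightarrow> 'b::banach"
  assumes f: "bounded_linear f" and cl: "closed (range f)"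
  obtains K where "K > 0" "\<And>y. y \<in> range f \<Longrightarrow> \<exists>x. f x = y \<and> norm x \<le> K * norm y"
proof -
  interpret f: bounded_linear f by (rule f)
  define S where "S = range f"
  define C where "C n = S \<inter> closure (f ` cball 0 (real n))" for n :: nat
  have sub: "subspace S"
    unfolding S_def using f.linear_axioms linear_subspace_image subspace_UNIV by blast
  have "completely_metrizable_space (top_of_set S)"
    by (rule completely_metrizable_space_closedin[OF completely_metrizable_space_euclidean])
       (use cl in \<open>simp add: S_def\<close>)
  have "S = (\<Union>n. C n)"
  proof -
    have "f x \<in> C (nat \<lceil>norm x\<rceil>)" for x
    proof -
      have "x \<in> cball 0 (real (nat \<lceil>norm x\<rceil>))"
        by (simp add: real_nat_ceiling_ge)
      then have "f x \<in> closure (f ` cball 0 (real (nat \<lceil>norm x\<rceil>)))"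
        by (intro subsetD[OF closure_subset] imageI)
      then show ?thesis by (simp add: C_def S_def)
    qed
    then have "S \<subseteq> (\<Union>n. C n)" by (auto simp: S_def)
    moreover have "C n \<subseteq> S" for n by (simp add: C_def)
    ultimately show ?thesis by blast
  qed
  have "\<exists>n. top_of_set S interior_of C n \<noteq> {}"
  proof (rule ccontr)
    assume neg: "\<nexists>n. top_of_set S interior_of C n \<noteq> {}"
    have "top_of_set S interior_of \<Union>(range C) = {}"
    proof (rule Baire_category_alt)
      show "completely_metrizable_space (top_of_set S) \<or>
            locally_compact_space (top_of_set S) \<and> regular_space (top_of_set S)"
        using \<open>completely_metrizable_space (top_of_set S)\<close> by blast
      fix T assume "T \<in> range C"
      then show "closedin (top_of_set S) T \<and> top_of_set S interior_of T = {}"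
        using neg by (auto simp: C_def closedin_closed_Int)
    qed simp
    with \<open>S = (\<Union>n. C n)\<close> have "top_of_set S interior_of S = {}" by simp
    moreover have "top_of_set S interior_of S = S"
      by (metis interior_of_topspace topspace_euclidean_subtopology)
    ultimately show False using subspace_0[OF sub] by simp
  qed
  then obtain n y0 where y0: "y0 \<in> top_of_set S interior_of C n" by blast
  then obtain U where U: "openin (top_of_set S) U" "y0 \<in> U" "U \<subseteq> C n"
    by (auto simp: interior_of_def)
  then obtain r where r: "r > 0" "ball y0 r \<inter> S \<subseteq> U"
    by (meson openin_contains_ball)
  have y0S: "y0 \<in> S" using U openin_imp_subset by blast
  have y0cl: "y0 \<in> closure (f ` cball 0 (real n))" using U by (auto simp: C_def)
  define \<kappa> where "\<kappa> = 4 * real n / r"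
  \<comment> \<open>A small multiple \<open>t y\<close> is the difference of the points \<open>y0 + t y\<close> and \<open>y0\<close> of the closure; errors below \<open>r / 8\<close> for each leave \<open>norm y / 2\<close> after division by \<open>t\<close>.\<close>
  have approx: "\<exists>x. norm x \<le> \<kappa> * norm y \<and> norm (y - f x) \<le> norm y / 2" if yS: "y \<in> S" for y
  proof (cases "y = 0")
    case True
    then show ?thesis by (intro exI[of _ 0]) (simp add: f.zero)
  next
    case False
    define t where "t = r / (2 * norm y)"
    have t: "t > 0" using False r by (simp add: t_def)
    have "y0 + t *\<^sub>R y \<in> S" using yS y0S sub by (simp add: subspace_add subspace_scale)
    moreover have "y0 + t *\<^sub>R y \<in> ball y0 r"
      using False r by (simp add: t_def dist_norm)
    ultimately have "y0 + t *\<^sub>R y \<in> closure (f ` cball 0 (real n))"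
      using r U by (auto simp: C_def)
    then obtain a where a: "norm a \<le> real n" "norm (f a - (y0 + t *\<^sub>R y)) < r / 8"
      using r(1) unfolding closure_approachable dist_norm
      by (metis (no_types, lifting) imageE mem_cball_0 divide_pos_pos zero_less_numeral)
    obtain b where b: "norm b \<le> real n" "norm (f b - y0) < r / 8"
      using r(1) y0cl unfolding closure_approachable dist_norm
      by (metis (no_types, lifting) imageE mem_cball_0 divide_pos_pos zero_less_numeral)
    define x where "x = (1 / t) *\<^sub>R (a - b)"
    have "norm x \<le> (1 / t) * (real n + real n)"
      using a b t norm_triangle_ineq4[of a b] by (simp add: x_def divide_right_mono)
    also have "\<dots> = \<kappa> * norm y" by (simp add: t_def \<kappa>_def)
    finally have 1: "norm x \<le> \<kappa> * norm y" .
    have "y - f x = (1 / t) *\<^sub>R ((f b - y0) - (f a - (y0 + t *\<^sub>R y)))"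
      using t by (simp add: x_def f.scaleR f.diff algebra_simps)
    also have "norm \<dots> \<le> (1 / t) * (r / 8 + r / 8)"
    proof -
      have "norm ((f b - y0) - (f a - (y0 + t *\<^sub>R y))) \<le> r / 8 + r / 8"
        by (rule order_trans[OF norm_triangle_ineq4]) (use a b in simp)
      then have "(1 / t) * norm ((f b - y0) - (f a - (y0 + t *\<^sub>R y))) \<le> (1 / t) * (r / 8 + r / 8)"
        by (rule mult_left_mono) (use t in simp)
      then show ?thesis using t by simp
    qed
    also have "\<dots> = norm y / 2" using r by (simp add: t_def)
    finally show ?thesis using 1 by blast
  qed
  then obtain g where g: "\<And>y. y \<in> S \<Longrightarrow> norm (g y) \<le> \<kappa> * norm y"
      "\<And>y. y \<in> S \<Longrightarrow> norm (y - f (g y)) \<le> norm y / 2" by metis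
  have \<kappa>: "\<kappa> \<ge> 0" using r by (simp add: \<kappa>_def)
  have main: "\<exists>x. f x = y \<and> norm x \<le> (2 * \<kappa> + 1) * norm y" if yS: "y \<in> S" for y
  proof -
    \<comment> \<open>the successive remainders\<close>
    define z where "z k = ((\<lambda>y. y - f (g y)) ^^ k) y" for k
    have z_Suc: "z (Suc k) = z k - f (g (z k))" for k by (simp add: z_def)
    have zS: "z k \<in> S" for k
    proof (induction k)
      case (Suc k)
      then show ?case using sub by (auto simp: z_Suc subspace_diff S_def)
    qed (simp add: z_def yS)
    have nz: "norm (z k) \<le> norm y * (1/2) ^ k" for k
    proof (induction k)
      case (Suc k)
      then show ?case using g(2)[OF zS[of k]] by (simp add: z_Suc)
    qed (simp add: z_def)
    have ng: "norm (g (z k)) \<le> \<kappa> * norm y * (1/2) ^ k" for k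
      using g(1)[OF zS[of k]] mult_left_mono[OF nz[of k] \<kappa>] by (simp add: mult.assoc)
    have gsum: "(\<lambda>k. \<kappa> * norm y * (1/2) ^ k) sums (\<kappa> * norm y * 2)"
      using sums_mult[OF geometric_sums[of "1/2::real"], of "\<kappa> * norm y"] by simp
    then have sg: "summable (\<lambda>k. g (z k))"
      using ng by (intro summable_comparison_test[OF _ sums_summable[OF gsum]]) blast
    define x where "x = suminf (\<lambda>k. g (z k))"
    have "(\<lambda>k. f (g (z k))) sums f x"
      unfolding x_def by (rule f.sums[OF summable_sums[OF sg]])
    moreover have "(\<lambda>k. f (g (z k))) sums y"
    proof -
      have part: "(\<Sum>k<n. f (g (z k))) = y - z n" for n
        by (induction n) (simp_all add: z_Suc, simp add: z_def)
      have "z \<longlonglongrightarrow> 0"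
      proof (rule Lim_null_comparison)
        show "\<forall>\<^sub>F k in sequentially. norm (z k) \<le> norm y * (1/2) ^ k" using nz by simp
        show "(\<lambda>k. norm y * (1/2) ^ k) \<longlonglongrightarrow> 0"
          by (intro tendsto_mult_right_zero LIMSEQ_power_zero) simp
      qed
      then show ?thesis unfolding sums_def part by (auto intro!: tendsto_eq_intros)
    qed
    ultimately have "f x = y" by (rule sums_unique2)
    moreover have "norm x \<le> \<kappa> * norm y * 2"
      unfolding x_def using suminf_le[OF _ _ sums_summable[OF gsum]] ng sums_unique[OF gsum]
      by (metis (no_types, lifting) norm_suminf_le sums_summable[OF gsum])
    ultimately show ?thesis
      by (intro exI[of _ x]) (simp add: algebra_simps add_increasing)
  qed
  then show thesis using that[of "2 * \<kappa> + 1"] \<kappa> unfolding S_def by simp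
qed

section \<open>Limits of operators on finite-dimensional subspaces\<close>

text \<open>A cluster point exists by Tychonoff's theorem, in a product of compact intervals of arbitrary
  cardinality. Refining the filter makes it a limit, so that the usual calculus of limits applies.\<close>

lemma pointwise_bounded_subfilter_convergent:
  fixes v :: "'i \<Rightarrow> 'a \<Rightarrow> real"
  assumes "F \<noteq> bot" and bd: "\<And>x. eventually (\<lambda>i. \<bar>v i x\<bar> \<le> K x) F"
  obtains F' u where "F' \<le> F" "F' \<noteq> bot" "\<And>x. ((\<lambda>i. v i x) \<longlongrightarrow> u x) F'"
proof -
  \<comment> \<open>The bound holds at each point only eventually, and not uniformly; truncation makes it hold always and eventually changes nothing at any given point.\<close>
  define w where "w i x = max (- \<bar>K x\<bar>) (min \<bar>K x\<bar> (v i x))" for i x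
  define Q where "Q = (\<Pi>\<^sub>E x\<in>UNIV. {- \<bar>K x\<bar> .. \<bar>K x\<bar>})"
  have "compactin (product_topology (\<lambda>_::'a. euclidean :: real topology) UNIV) Q"
    unfolding Q_def compactin_PiE by (simp add: compactin_euclidean_iff)
  then have "compact Q" unfolding euclidean_product_topology by simp
  moreover have "filtermap w F \<noteq> bot" using assms(1) by (simp add: filtermap_bot_iff)
  moreover have "eventually (\<lambda>c. c \<in> Q) (filtermap w F)"
    by (simp add: eventually_filtermap Q_def w_def PiE_UNIV_domain)
  ultimately obtain u where u: "inf (nhds u) (filtermap w F) \<noteq> bot"
    unfolding compact_filter by blast
  define F' where "F' = inf F (filtercomap w (nhds u))"
  have "F' \<noteq> bot"
  proof
    assume "F' = bot"
    then obtain P Q where P: "eventually P F" and Q: "eventually Q (nhds u)"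
      and PQ: "\<And>i. P i \<Longrightarrow> \<not> Q (w i)"
      unfolding F'_def trivial_limit_def eventually_inf eventually_filtercomap by blast
    have "eventually (\<lambda>c. \<not> Q c) (filtermap w F)"
      unfolding eventually_filtermap using P by eventually_elim (rule PQ)
    with Q have "eventually (\<lambda>_. False) (inf (nhds u) (filtermap w F))"
      unfolding eventually_inf by blast
    with u show False by (simp add: trivial_limit_def)
  qed
  moreover have "F' \<le> F" by (simp add: F'_def)
  moreover have "((\<lambda>i. v i x) \<longlongrightarrow> u x) F'" for x
  proof -
    have "filterlim w (nhds u) F'"
      unfolding F'_def by (rule filterlim_mono[OF filterlim_filtercomap]) auto
    then have "((\<lambda>i. w i x) \<longlongrightarrow> u x) F'"
      by (rule continuous_on_tendsto_compose[OF continuous_on_product_coordinates]) simp_all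
    moreover have "eventually (\<lambda>i. w i x = v i x) F'"
      by (rule filter_leD[OF \<open>F' \<le> F\<close>]) (use bd[of x] in eventually_elim, auto simp: w_def)
    ultimately show ?thesis by (simp add: tendsto_cong)
  qed
  ultimately show thesis by (intro that)
qed

lemma lookup_scaleR:
  fixes x :: "'a \<Rightarrow>\<^sub>0 'b::real_vector"
  shows "Poly_Mapping.lookup (c *\<^sub>R x) i = c *\<^sub>R Poly_Mapping.lookup x i"
proof -
  have "finite {i. c *\<^sub>R Poly_Mapping.lookup x i \<noteq> 0}"
    by (rule finite_subset[OF _ finite_keys[of x]]) (auto simp: in_keys_iff)
  then show ?thesis by (simp add: scaleR_poly_mapping_def Abs_poly_mapping_inverse)
qed

text \<open>A factorization of the inclusion of \<open>S\<close> through \<open>\<ell>\<^sub>1\<^sup>n\<close>: the coordinates \<open>\<phi>\<close> form an operator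
  of norm at most one, and \<open>g\<close> lists the images of the unit vectors under the second factor. It
  arises from an isomorphism of \<open>\<ell>\<^sub>1\<^sup>n\<close> with a space that contains \<open>S\<close>. The vectors \<open>g i\<close> may lie
  outside of \<open>S\<close>, so that a frame can be restricted to smaller subspaces.\<close>

definition ell1_frame ::
    "real \<Rightarrow> 'a::real_normed_vector set \<Rightarrow> nat \<Rightarrow> (nat \<Rightarrow> 'a \<Rightarrow> real) \<Rightarrow> (nat \<Rightarrow> 'a) \<Rightarrow> bool" where
  "ell1_frame \<mu> S n \<phi> g \<longleftrightarrow>
     (\<forall>i<n. \<forall>x\<in>S. \<forall>y\<in>S. \<phi> i (x + y) = \<phi> i x + \<phi> i y) \<and>
     (\<forall>i<n. \<forall>x\<in>S. \<forall>c. \<phi> i (c *\<^sub>R x) = c * \<phi> i x) \<and>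
     (\<forall>x\<in>S. (\<Sum>i<n. \<phi> i x *\<^sub>R g i) = x \<and> (\<Sum>i<n. \<bar>\<phi> i x\<bar>) \<le> norm x) \<and>
     (\<forall>i<n. norm (g i) \<le> \<mu>)"

lemma norm_le_onorm_on:
  assumes "onorm_on S f = ereal a" "x \<in> S" "f 0 = 0"
  shows "norm (f x) \<le> a * norm x"
proof (cases "x = 0")
  case False
  have "ereal (norm (f x) / norm x) \<le> onorm_on S f"
    unfolding onorm_on_def by (rule SUP_upper[OF assms(2)])
  then show ?thesis using False by (simp add: assms(1) divide_simps)
qed (simp add: assms(3))

text \<open>The infimum in the distance need not be attained, whence the frame constant exceeds \<open>\<mu>\<close>.\<close>

lemma ell1_frame_of_banach_mazur_dist:
  fixes G :: "'a::real_normed_vector set"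
  assumes G: "subspace G" and dist: "banach_mazur_dist G (ell1 n) \<le> ereal \<mu>" and \<mu>: "\<mu> \<ge> 0"
  shows "\<exists>\<phi> g. ell1_frame (\<mu> + 1) G n \<phi> g"
proof (cases "G = {0}")
  case True
  then show ?thesis
    by (intro exI[of _ "\<lambda>_ _. 0"] exI[of _ "\<lambda>_. 0"]) (use \<mu> in \<open>simp add: ell1_frame_def\<close>)
next
  case False
  \<comment> \<open>A nonzero vector forces both operator norms to be positive, so that a finite product makes both finite.\<close>
  then obtain x0 where x0: "x0 \<in> G" "x0 \<noteq> 0" using subspace_0[OF G] by blast
  have "banach_mazur_dist G (ell1 n) < ereal (\<mu> + 1)"
    using dist by (rule le_less_trans) simp
  then obtain f where f: "linear_bij_betw f G (ell1 n)"
    and prod: "onorm_on G f * onorm_on (ell1 n) (inv_into G f) < ereal (\<mu> + 1)"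
    unfolding banach_mazur_dist_def by (auto simp: INF_less_iff)
  define h where "h = inv_into G f"
  have bij: "bij_betw f G (ell1 n)" and add: "\<And>x y. x \<in> G \<Longrightarrow> y \<in> G \<Longrightarrow> f (x + y) = f x + f y"
    and scale: "\<And>c x. x \<in> G \<Longrightarrow> f (c *\<^sub>R x) = c *\<^sub>R f x"
    using f by (auto simp: linear_bij_betw_def)
  have inj: "inj_on f G" and img: "f ` G = ell1 n" using bij by (auto simp: bij_betw_def)
  have f0: "f 0 = 0" using scale[of 0 0] subspace_0[OF G] by simp
  have z0: "0 \<in> ell1 n" by (simp add: ell1_def)
  have h0: "h 0 = 0" unfolding h_def using inj f0 subspace_0[OF G] by (metis inv_into_f_f)
  have hG: "h y \<in> G" if "y \<in> ell1 n" for y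
    unfolding h_def using that img by (simp add: inv_into_into)
  have fh: "f (h y) = y" if "y \<in> ell1 n" for y
    unfolding h_def using that img by (simp add: f_inv_into_f)
  have fx0: "f x0 \<noteq> 0" using x0 inj f0 subspace_0[OF G] by (metis inj_onD)
  have fx0': "f x0 \<in> ell1 n" using x0 img by blast
  have hf0: "h (f x0) = x0" unfolding h_def using inj x0 by simp
  have apos: "0 < onorm_on G f"
    unfolding onorm_on_def
    by (rule less_le_trans[OF _ SUP_upper[OF x0(1)]]) (use x0 fx0 in simp)
  have bpos: "0 < onorm_on (ell1 n) h"
    unfolding onorm_on_def
    by (rule less_le_trans[OF _ SUP_upper[OF fx0']]) (use x0 fx0 hf0 in simp)
  obtain \<alpha> \<beta> where ab: "onorm_on G f = ereal \<alpha>" "onorm_on (ell1 n) h = ereal \<beta>"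
    using prod apos bpos unfolding h_def[symmetric]
    by (cases "onorm_on G f"; cases "onorm_on (ell1 n) h") auto
  have \<alpha>: "\<alpha> > 0" and \<alpha>\<beta>: "\<alpha> * \<beta> \<le> \<mu> + 1"
    using apos prod ab unfolding h_def[symmetric] by auto
  define e where "e i = Poly_Mapping.single i (1::real)" for i :: nat
  have e: "e i \<in> ell1 n" if "i < n" for i using that by (simp add: e_def ell1_def)
  have fsum: "f (\<Sum>i\<in>I. c i *\<^sub>R h (e i)) = (\<Sum>i\<in>I. c i *\<^sub>R e i) \<and> (\<Sum>i\<in>I. c i *\<^sub>R h (e i)) \<in> G"
    if "finite I" "I \<subseteq> {..<n}" for I c
    using that
  proof (induction I rule: finite_induct)
    case empty
    then show ?case using f0 subspace_0[OF G] by simp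
  next
    case (insert i I)
    then show ?case using e[of i] hG[OF e, of i] G
      by (simp add: add scale subspace_scale subspace_add fh)
  qed
  have expand: "(\<Sum>i<n. Poly_Mapping.lookup y i *\<^sub>R e i) = y" if "y \<in> ell1 n" for y
  proof (rule poly_mapping_eqI)
    fix k
    have "Poly_Mapping.lookup (\<Sum>i<n. Poly_Mapping.lookup y i *\<^sub>R e i) k =
        (\<Sum>i<n. if i = k then Poly_Mapping.lookup y i else 0)"
      unfolding lookup_sum
      by (rule sum.cong) (simp_all add: lookup_scaleR e_def lookup_single when_def)
    also have "\<dots> = Poly_Mapping.lookup y k"
      using that by (cases "k < n") (auto simp: ell1_def in_keys_iff sum.delta)
    finally show "Poly_Mapping.lookup (\<Sum>i<n. Poly_Mapping.lookup y i *\<^sub>R e i) k =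
        Poly_Mapping.lookup y k" .
  qed
  define \<phi> where "\<phi> i x = Poly_Mapping.lookup (f x) i / \<alpha>" for i x
  define g where "g i = \<alpha> *\<^sub>R h (e i)" for i
  have "ell1_frame (\<mu> + 1) G n \<phi> g"
    unfolding ell1_frame_def
  proof (intro conjI ballI allI impI)
    fix x assume x: "x \<in> G"
    then have fx: "f x \<in> ell1 n" using img by blast
    have "(\<Sum>i<n. \<phi> i x *\<^sub>R g i) = (\<Sum>i<n. Poly_Mapping.lookup (f x) i *\<^sub>R h (e i))"
      using \<alpha> by (simp add: \<phi>_def g_def)
    also have "\<dots> = x"
      by (rule inj_onD[OF inj]) (use fsum[of "{..<n}"] expand[OF fx] x in auto)
    finally show "(\<Sum>i<n. \<phi> i x *\<^sub>R g i) = x" .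
    have "(\<Sum>i<n. \<bar>\<phi> i x\<bar>) = norm (f x) / \<alpha>"
      using \<alpha> by (simp add: \<phi>_def norm_ell1[OF fx] sum_divide_distrib)
    also have "\<dots> \<le> norm x"
      using norm_le_onorm_on[OF ab(1) x f0] \<alpha> by (simp add: divide_simps mult.commute)
    finally show "(\<Sum>i<n. \<bar>\<phi> i x\<bar>) \<le> norm x" .
  next
    fix i assume i: "i < n"
    have "norm (e i) = 1"
      by (subst norm_ell1[OF e[OF i]])
         (use i in \<open>simp add: e_def lookup_single when_def if_distrib cong: if_cong\<close>)
    then have "norm (h (e i)) \<le> \<beta>"
      using norm_le_onorm_on[OF ab(2) e[OF i] h0] by simp
    then have "norm (g i) \<le> \<alpha> * \<beta>" using \<alpha> by (simp add: g_def)
    then show "norm (g i) \<le> \<mu> + 1" using \<alpha>\<beta> by simp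
  next
    fix i x y assume "x \<in> G" "y \<in> G"
    then show "\<phi> i (x + y) = \<phi> i x + \<phi> i y"
      by (simp add: \<phi>_def add lookup_add add_divide_distrib)
  next
    fix i x c assume "x \<in> G"
    then show "\<phi> i (c *\<^sub>R x) = c * \<phi> i x" by (simp add: \<phi>_def scale lookup_scaleR)
  qed
  then show ?thesis by blast
qed

lemma ell1_frame_subset: "ell1_frame \<mu> G n \<phi> g \<Longrightarrow> S \<subseteq> G \<Longrightarrow> ell1_frame \<mu> S n \<phi> g"
  unfolding ell1_frame_def by blast

text \<open>The spans of the finite sets, ordered by inclusion of the sets, exhaust the space, so that limits
  along \<open>finite_subsets_at_top UNIV\<close> extend constructions on the frames to the whole space.\<close>

locale ell1_frames =
  fixes \<mu> :: real
    and n :: "'a::real_normed_vector set \<Rightarrow> nat"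
    and \<phi> :: "'a set \<Rightarrow> nat \<Rightarrow> 'a \<Rightarrow> real"
    and g :: "'a set \<Rightarrow> nat \<Rightarrow> 'a"
  assumes \<mu>_nonneg: "0 \<le> \<mu>"
    and frame: "finite A \<Longrightarrow> ell1_frame \<mu> (span A) (n A) (\<phi> A) (g A)"

lemma L1_space_ell1_frames:
  assumes "is_L1_space TYPE('a::banach)"
  obtains \<mu> n \<phi> and g :: "'a::banach set \<Rightarrow> nat \<Rightarrow> 'a" where "ell1_frames \<mu> n \<phi> g"
proof -
  obtain \<mu> where \<mu>: "\<mu> \<ge> 1" and G: "\<And>F::'a set. finite_dim F \<Longrightarrow>
        \<exists>G. finite_dim G \<and> F \<subseteq> G \<and> banach_mazur_dist G (ell1 (dim G)) \<le> ereal \<mu>"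
    using assms unfolding is_L1_space_def by blast
  have "\<forall>A::'a set. \<exists>n \<phi> g. finite A \<longrightarrow> ell1_frame (\<mu> + 1) (span A) n \<phi> g"
  proof
    fix A :: "'a set"
    show "\<exists>n \<phi> g. finite A \<longrightarrow> ell1_frame (\<mu> + 1) (span A) n \<phi> g"
    proof (cases "finite A")
      case True
      then have "finite_dim (span A)" unfolding finite_dim_def by blast
      then obtain G where G: "finite_dim G" "span A \<subseteq> G"
          "banach_mazur_dist G (ell1 (dim G)) \<le> ereal \<mu>"
        using G by blast
      then have "subspace G" by (auto simp: finite_dim_def)
      then show ?thesis
        using ell1_frame_of_banach_mazur_dist[OF _ G(3)] ell1_frame_subset[OF _ G(2)] \<mu> by fastforce
    qed simp
  qed
  then obtain n \<phi> and g :: "'a set \<Rightarrow> nat \<Rightarrow> 'a"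
    where "\<forall>A. finite A \<longrightarrow> ell1_frame (\<mu> + 1) (span A) (n A) (\<phi> A) (g A)" by metis
  then have "ell1_frames (\<mu> + 1) n \<phi> g" using \<mu> by unfold_locales auto
  then show thesis by (rule that)
qed

context ell1_frames
begin

lemma frame_add: "finite A \<Longrightarrow> x \<in> span A \<Longrightarrow> y \<in> span A \<Longrightarrow> i < n A \<Longrightarrow>
    \<phi> A i (x + y) = \<phi> A i x + \<phi> A i y"
  and frame_scaleR: "finite A \<Longrightarrow> x \<in> span A \<Longrightarrow> i < n A \<Longrightarrow> \<phi> A i (c *\<^sub>R x) = c * \<phi> A i x"
  and frame_expand: "finite A \<Longrightarrow> x \<in> span A \<Longrightarrow> (\<Sum>i<n A. \<phi> A i x *\<^sub>R g A i) = x"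
  and frame_norm: "finite A \<Longrightarrow> x \<in> span A \<Longrightarrow> (\<Sum>i<n A. \<bar>\<phi> A i x\<bar>) \<le> norm x"
  and frame_vector: "finite A \<Longrightarrow> i < n A \<Longrightarrow> norm (g A i) \<le> \<mu>"
  using frame[of A] unfolding ell1_frame_def by blast+

text \<open>For each finite \<open>A\<close>, the numbers \<open>\<tau> A i c\<close> prescribe an operator from \<open>span A\<close> to \<open>\<ell>\<^sub>1\<close> over the
  index set \<open>C\<close> by its values on the vectors \<open>g A i\<close>, and the \<open>\<ell>\<^sub>1\<close>-norm of the coordinates
  turns the bound \<open>K\<close> on these values into a bound on the operator. As \<open>C\<close> is fixed, the
  entries at each vector stay in a compact interval. Every vector lies in \<open>span A\<close> eventually,
  so linearity and the bound pass to a limit.\<close>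

lemma coordinate_limit:
  fixes \<tau> :: "'a set \<Rightarrow> nat \<Rightarrow> 'c \<Rightarrow> real"
  assumes C: "finite C" and K: "0 \<le> K"
    and \<tau>: "\<And>A i. finite A \<Longrightarrow> i < n A \<Longrightarrow> (\<Sum>c\<in>C. \<bar>\<tau> A i c\<bar>) \<le> K"
  obtains F s where "F \<le> finite_subsets_at_top UNIV" "F \<noteq> bot"
    "\<And>x c. c \<in> C \<Longrightarrow> ((\<lambda>A. \<Sum>i<n A. \<phi> A i x * \<tau> A i c) \<longlongrightarrow> s c x) F"
    "\<And>c. c \<in> C \<Longrightarrow> bounded_linear (s c)" "\<And>x. (\<Sum>c\<in>C. \<bar>s c x\<bar>) \<le> K * norm x"
proof -
  define v where "v A c x = (\<Sum>i<n A. \<phi> A i x * \<tau> A i c)" for A c x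
  have vsum: "(\<Sum>c\<in>C. \<bar>v A c x\<bar>) \<le> K * norm x" if A: "finite A" "x \<in> span A" for A x
  proof -
    have "(\<Sum>c\<in>C. \<bar>v A c x\<bar>) \<le> (\<Sum>c\<in>C. \<Sum>i<n A. \<bar>\<phi> A i x\<bar> * \<bar>\<tau> A i c\<bar>)"
      unfolding v_def abs_mult[symmetric] by (intro sum_mono sum_abs)
    also have "\<dots> = (\<Sum>i<n A. \<bar>\<phi> A i x\<bar> * (\<Sum>c\<in>C. \<bar>\<tau> A i c\<bar>))"
      unfolding sum_distrib_left by (rule sum.swap)
    also have "\<dots> \<le> (\<Sum>i<n A. \<bar>\<phi> A i x\<bar> * K)"
      using \<tau>[OF A(1)] by (intro sum_mono mult_left_mono) auto
    also have "\<dots> \<le> norm x * K"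
      using frame_norm[OF A] K by (simp add: mult_right_mono flip: sum_distrib_right)
    finally show ?thesis by (simp add: mult.commute)
  qed
  have ev: "eventually (\<lambda>A. finite A \<and> x \<in> span A) (finite_subsets_at_top UNIV)" for x :: 'a
    unfolding eventually_finite_subsets_at_top
    by (rule exI[of _ "{x}"]) (auto intro: span_base)
  have bd: "eventually (\<lambda>A. \<bar>if snd p \<in> C then v A (snd p) (fst p) else 0\<bar> \<le> K * norm (fst p))
      (finite_subsets_at_top UNIV)" for p
    using ev[of "fst p"]
  proof eventually_elim
    case (elim A)
    have "\<bar>v A c (fst p)\<bar> \<le> (\<Sum>c\<in>C. \<bar>v A c (fst p)\<bar>)" if "c \<in> C" for c
      by (rule member_le_sum) (use that C in auto)
    with vsum[of A "fst p"] elim K show ?case by force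
  qed
  obtain F s' where F: "F \<le> finite_subsets_at_top UNIV" "F \<noteq> bot"
    and lim: "\<And>p. ((\<lambda>A. if snd p \<in> C then v A (snd p) (fst p) else 0) \<longlongrightarrow> s' p) F"
    by (rule pointwise_bounded_subfilter_convergent[OF finite_subsets_at_top_neq_bot bd]) (rule that)
  define s where "s c x = s' (x, c)" for c x
  have lims: "((\<lambda>A. v A c x) \<longlongrightarrow> s c x) F" if "c \<in> C" for c x
    using lim[of "(x, c)"] that by (simp add: s_def)
  have evF: "eventually (\<lambda>A. finite A \<and> x \<in> span A) F" for x
    by (rule filter_leD[OF F(1) ev])
  have sK: "(\<Sum>c\<in>C. \<bar>s c x\<bar>) \<le> K * norm x" for x
  proof (rule tendsto_upperbound[OF _ _ F(2)])
    show "((\<lambda>A. \<Sum>c\<in>C. \<bar>v A c x\<bar>) \<longlongrightarrow> (\<Sum>c\<in>C. \<bar>s c x\<bar>)) F"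
      by (intro tendsto_sum tendsto_rabs lims)
    show "eventually (\<lambda>A. (\<Sum>c\<in>C. \<bar>v A c x\<bar>) \<le> K * norm x) F"
      using evF[of x] by eventually_elim (use vsum in blast)
  qed
  have "bounded_linear (s c)" if c: "c \<in> C" for c
  proof (rule bounded_linear_intro[where K = K])
    fix x y
    have "((\<lambda>A. v A c x + v A c y) \<longlongrightarrow> s c x + s c y) F"
      by (intro tendsto_add lims c)
    moreover have "eventually (\<lambda>A. v A c x + v A c y = v A c (x + y)) F"
      using evF[of x] evF[of y]
      by eventually_elim (simp add: v_def frame_add distrib_right sum.distrib)
    ultimately have "((\<lambda>A. v A c (x + y)) \<longlongrightarrow> s c x + s c y) F"
      by (rule Lim_transform_eventually)
    then show "s c (x + y) = s c x + s c y"
      using tendsto_unique[OF F(2) lims[OF c]] by blast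
  next
    fix r x
    have "((\<lambda>A. r * v A c x) \<longlongrightarrow> r * s c x) F"
      by (intro tendsto_mult_left lims c)
    moreover have "eventually (\<lambda>A. r * v A c x = v A c (r *\<^sub>R x)) F"
      using evF[of x]
      by eventually_elim (simp add: v_def frame_scaleR sum_distrib_left mult.assoc)
    ultimately have "((\<lambda>A. v A c (r *\<^sub>R x)) \<longlongrightarrow> r * s c x) F"
      by (rule Lim_transform_eventually)
    then show "s c (r *\<^sub>R x) = r *\<^sub>R s c x"
      using tendsto_unique[OF F(2) lims[OF c]] by simp
  next
    fix x
    have "\<bar>s c x\<bar> \<le> (\<Sum>c\<in>C. \<bar>s c x\<bar>)"
      by (rule member_le_sum) (use c C in auto)
    then show "norm (s c x) \<le> norm x * K" using sK[of x] by (simp add: mult.commute)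
  qed
  from that[OF F lims[unfolded v_def] this sK] show thesis .
qed

end

section \<open>The bounded approximation property\<close>

text \<open>On a cell of indices where the ratio \<open>u / w\<close> varies by at most \<open>e\<close>, the function \<open>u\<close> nearly
  equals the multiple of \<open>w\<close> with the same total. If \<open>w\<close> vanishes on the cell then so does \<open>u\<close>, and
  division by zero gives the correct value.\<close>

lemma cell_average_error:
  fixes u w :: "'i \<Rightarrow> real"
  assumes fin: "finite I" and i: "i \<in> I" and w: "\<And>k. k \<in> I \<Longrightarrow> 0 \<le> w k"
    and lo: "\<And>k. k \<in> I \<Longrightarrow> t * w k \<le> u k" and hi: "\<And>k. k \<in> I \<Longrightarrow> u k \<le> (t + e) * w k"
  shows "\<bar>u i - sum u I * (w i / sum w I)\<bar> \<le> e * w i"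
proof (cases "sum w I = 0")
  case True
  then have "\<forall>k\<in>I. w k = 0" using fin w by (simp add: sum_nonneg_eq_0_iff)
  then have "w i = 0" using i by blast
  then show ?thesis using lo[OF i] hi[OF i] by simp
next
  case False
  then have W: "sum w I > 0" using sum_nonneg[of I w] w by force
  define r where "r = w i / sum w I"
  have r: "r \<ge> 0" using W w[OF i] by (simp add: r_def)
  have "t * sum w I \<le> sum u I" "sum u I \<le> (t + e) * sum w I"
    unfolding sum_distrib_left by (intro sum_mono lo hi; assumption)+
  then have "t * sum w I * r \<le> sum u I * r" "sum u I * r \<le> (t + e) * sum w I * r"
    using r by (simp_all add: mult_right_mono)
  moreover have "sum w I * r = w i" using W by (simp add: r_def)
  ultimately have "t * w i \<le> sum u I * r" "sum u I * r \<le> (t + e) * w i"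
    by (simp_all only: mult.assoc)
  moreover have "(t + e) * w i = t * w i + e * w i" by (simp add: distrib_right)
  ultimately show ?thesis
    using lo[OF i] hi[OF i] unfolding r_def by linarith
qed

context ell1_frames
begin

text \<open>Call the family of the coordinates \<open>\<phi> A i f\<close> for \<open>f \<in> B\<close>, divided by its \<open>\<ell>\<^sub>1\<close>-norm \<open>w A i\<close>, the
  direction of \<open>i\<close>. Rounding the directions to multiples of \<open>\<epsilon>\<close> sorts the indices into cells,
  whose labels come from a finite set \<open>C\<close> that does not depend on \<open>A\<close>. The operator that adds up
  the coordinates in each cell and redistributes the total in proportion to \<open>w\<close> does not increase
  \<open>\<ell>\<^sub>1\<close>-norms, and moves a vector of \<open>B\<close> only by the error made in rounding. Its first half, the
  cell totals, has values in \<open>\<ell>\<^sub>1\<close> over \<open>C\<close> and therefore a limit \<open>s\<close> on the whole space. For the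
  second half, one set \<open>A\<close> suffices: one whose cell totals on \<open>B\<close> are already close to \<open>s\<close>.\<close>

lemma approximate_identity:
  fixes B :: "'a set"
  assumes B: "finite B" and \<delta>: "\<delta> > 0"
  obtains C :: "('a \<Rightarrow> int) set" and s b where "finite C" "\<And>c. c \<in> C \<Longrightarrow> bounded_linear (s c)"
    "\<And>x. (\<Sum>c\<in>C. \<bar>s c x\<bar>) \<le> norm x" "\<And>c. c \<in> C \<Longrightarrow> norm (b c) \<le> \<mu>"
    "\<And>f. f \<in> B \<Longrightarrow> norm (f - (\<Sum>c\<in>C. s c f *\<^sub>R b c)) \<le> \<delta>"
proof -
  define N where "N = (\<Sum>f\<in>B. norm f)"
  have N: "N \<ge> 0" by (simp add: N_def sum_nonneg)
  \<comment> \<open>The total rounding error on a vector of \<open>B\<close> will be at most \<open>\<epsilon> * \<mu> * N\<close>.\<close>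
  define \<epsilon> where "\<epsilon> = \<delta> / (2 * (\<mu> * N + 1))"
  have \<mu>N: "\<mu> * N \<ge> 0" using \<mu>_nonneg N by simp
  have \<epsilon>: "\<epsilon> > 0" "\<epsilon> * (\<mu> * N) \<le> \<delta> / 2"
    using \<delta> \<mu>N by (auto simp: \<epsilon>_def divide_simps intro!: mult_left_mono add_pos_nonneg)
  define w where "w A i = (\<Sum>f\<in>B. \<bar>\<phi> A i f\<bar>)" for A i
  have w0: "w A i \<ge> 0" for A i by (simp add: w_def sum_nonneg)
  have \<phi>w: "\<bar>\<phi> A i f\<bar> \<le> w A i" if "f \<in> B" for A i f
    unfolding w_def by (rule member_le_sum) (use that B in auto)
  define label where "label A i f = (if f \<in> B then \<lfloor>\<phi> A i f / (\<epsilon> * w A i)\<rfloor> else 0)" for A i f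
  define m where "m = \<lceil>1 / \<epsilon>\<rceil> + 1"
  define C where "C = {z. \<forall>f. (f \<in> B \<longrightarrow> z f \<in> {-m..m}) \<and> (f \<notin> B \<longrightarrow> z f = (0::int))}"
  have C: "finite C" unfolding C_def by (rule finite_set_of_finite_funs) (use B in auto)
  have labelC: "label A i \<in> C" for A i
  proof -
    have "label A i f \<in> {-m..m}" if f: "f \<in> B" for f
    proof -
      have "\<bar>\<phi> A i f / (\<epsilon> * w A i)\<bar> \<le> 1 / \<epsilon>"
        using \<phi>w[OF f, of A i] \<epsilon>(1) w0[of A i] by (cases "w A i = 0") (auto simp: abs_mult divide_simps)
      then have "- (1 / \<epsilon>) \<le> \<phi> A i f / (\<epsilon> * w A i)" "\<phi> A i f / (\<epsilon> * w A i) \<le> 1 / \<epsilon>"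
        by (simp_all only: abs_le_iff) auto
      moreover have "1 / \<epsilon> \<le> real_of_int m" unfolding m_def by linarith
      ultimately have "real_of_int (- m) \<le> \<phi> A i f / (\<epsilon> * w A i)"
          "\<phi> A i f / (\<epsilon> * w A i) < real_of_int m + 1" by linarith+
      then have "- m \<le> \<lfloor>\<phi> A i f / (\<epsilon> * w A i)\<rfloor>" "\<lfloor>\<phi> A i f / (\<epsilon> * w A i)\<rfloor> \<le> m"
        by (simp_all only: le_floor_iff floor_le_iff)
      then show ?thesis using f by (simp add: label_def)
    qed
    then show ?thesis by (simp add: C_def label_def)
  qed
  have floor_bounds: "\<epsilon> * real_of_int (label A i f) * w A i \<le> \<phi> A i f"
      "\<phi> A i f \<le> (\<epsilon> * real_of_int (label A i f) + \<epsilon>) * w A i" if f: "f \<in> B" for A i f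
  proof -
    show "\<epsilon> * real_of_int (label A i f) * w A i \<le> \<phi> A i f"
    proof (cases "w A i = 0")
      case False
      then have p: "\<epsilon> * w A i > 0" using w0[of A i] \<epsilon> by simp
      have "real_of_int (label A i f) \<le> \<phi> A i f / (\<epsilon> * w A i)" using f by (simp add: label_def)
      then show ?thesis using p by (simp add: pos_le_divide_eq mult_ac)
    qed (use \<phi>w[OF f, of A i] in simp)
    show "\<phi> A i f \<le> (\<epsilon> * real_of_int (label A i f) + \<epsilon>) * w A i"
    proof (cases "w A i = 0")
      case False
      then have p: "\<epsilon> * w A i > 0" using w0[of A i] \<epsilon> by simp
      have "\<phi> A i f / (\<epsilon> * w A i) \<le> real_of_int (label A i f) + 1" using f by (simp add: label_def)
      then show ?thesis using p by (simp add: pos_divide_le_eq algebra_simps)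
    qed (use \<phi>w[OF f, of A i] in simp)
  qed
  define \<tau> where "\<tau> A i c = (of_bool (label A i = c) :: real)" for A i c
  have \<tau>1: "(\<Sum>c\<in>C. \<bar>\<tau> A i c\<bar>) \<le> 1" for A i
    using C labelC[of A i] by (simp add: \<tau>_def of_bool_def if_distrib cong: if_cong)
  obtain F s where F: "F \<le> finite_subsets_at_top UNIV" "F \<noteq> bot"
    and lim: "\<And>x c. c \<in> C \<Longrightarrow> ((\<lambda>A. \<Sum>i<n A. \<phi> A i x * \<tau> A i c) \<longlongrightarrow> s c x) F"
    and s: "\<And>c. c \<in> C \<Longrightarrow> bounded_linear (s c)" "\<And>x. (\<Sum>c\<in>C. \<bar>s c x\<bar>) \<le> 1 * norm x"
    using coordinate_limit[OF C, of 1 \<tau>] \<tau>1 by auto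
  \<comment> \<open>\<open>\<eta>\<close> is the admissible distance of the cell totals from their limits; \<open>\<delta>\<close> is shared equally with the rounding error.\<close>
  define \<eta> where "\<eta> = \<delta> / (2 * (real (card C) * \<mu> + 1))"
  have C\<mu>: "real (card C) * \<mu> \<ge> 0" using \<mu>_nonneg by simp
  have \<eta>: "\<eta> > 0" "real (card C) * \<eta> * \<mu> \<le> \<delta> / 2"
    using \<delta> C\<mu> by (auto simp: \<eta>_def divide_simps intro!: mult_left_mono add_pos_nonneg)
  have "eventually (\<lambda>A. \<forall>f\<in>B. \<forall>c\<in>C. dist (\<Sum>i<n A. \<phi> A i f * \<tau> A i c) (s c f) < \<eta>) F"
    using B C lim \<eta>(1) by (intro eventually_ball_finite ballI tendstoD) auto
  moreover have "eventually (\<lambda>A. finite A \<and> B \<subseteq> A) F"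
    by (rule filter_leD[OF F(1)]) (use B in \<open>auto simp: eventually_finite_subsets_at_top\<close>)
  ultimately have "eventually (\<lambda>A. (\<forall>f\<in>B. \<forall>c\<in>C. dist (\<Sum>i<n A. \<phi> A i f * \<tau> A i c) (s c f) < \<eta>) \<and>
      finite A \<and> B \<subseteq> A) F" by (rule eventually_conj)
  then obtain A where A: "finite A" "B \<subseteq> A"
    and near: "\<forall>f\<in>B. \<forall>c\<in>C. dist (\<Sum>i<n A. \<phi> A i f * \<tau> A i c) (s c f) < \<eta>"
    using eventually_happens'[OF F(2)] by blast
  have close: "\<bar>(\<Sum>i<n A. \<phi> A i f * \<tau> A i c) - s c f\<bar> < \<eta>" if "f \<in> B" "c \<in> C" for f c
    using near that by (simp add: dist_real_def)
  define I where "I c = {i \<in> {..<n A}. label A i = c}" for c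
  have I: "finite (I c)" for c by (simp add: I_def)
  \<comment> \<open>A cell on which \<open>w\<close> vanishes gets \<open>b c = 0\<close>, by division by zero.\<close>
  define b where "b c = (\<Sum>i\<in>I c. (w A i / sum (w A) (I c)) *\<^sub>R g A i)" for c
  have b\<mu>: "norm (b c) \<le> \<mu>" for c
  proof -
    have "norm (b c) \<le> (\<Sum>i\<in>I c. \<bar>w A i / sum (w A) (I c)\<bar>) * \<mu>"
      unfolding b_def by (rule norm_sum_scaleR_le) (use frame_vector[OF A(1)] in \<open>auto simp: I_def\<close>)
    also have "(\<Sum>i\<in>I c. \<bar>w A i / sum (w A) (I c)\<bar>) = sum (w A) (I c) / sum (w A) (I c)"
      unfolding sum_divide_distrib using w0 by (intro sum.cong) (auto simp: sum_nonneg)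
    also have "\<dots> * \<mu> \<le> \<mu>" using \<mu>_nonneg by (simp add: divide_self_if)
    finally show ?thesis .
  qed
  have "norm (f - (\<Sum>c\<in>C. s c f *\<^sub>R b c)) \<le> \<delta>" if f: "f \<in> B" for f
  proof -
    define S where "S c = sum (\<lambda>i. \<phi> A i f) (I c)" for c
    have fA: "f \<in> span A" using f A by (auto intro: span_base)
    have group: "(\<Sum>c\<in>C. \<Sum>i\<in>I c. h i) = (\<Sum>i<n A. h i)" for h :: "nat \<Rightarrow> 'b::comm_monoid_add"
      unfolding I_def by (rule sum.group) (use C labelC in auto)
    have S: "S c = (\<Sum>i<n A. \<phi> A i f * \<tau> A i c)" for c
      unfolding S_def I_def \<tau>_def sum.inter_filter[OF finite_lessThan] by (rule sum.cong) auto
    have "f - (\<Sum>c\<in>C. S c *\<^sub>R b c) =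
        (\<Sum>c\<in>C. \<Sum>i\<in>I c. \<phi> A i f *\<^sub>R g A i) - (\<Sum>c\<in>C. S c *\<^sub>R b c)"
      unfolding group frame_expand[OF A(1) fA] ..
    also have "\<dots> = (\<Sum>c\<in>C. \<Sum>i\<in>I c. (\<phi> A i f - S c * (w A i / sum (w A) (I c))) *\<^sub>R g A i)"
      by (simp add: b_def sum_subtractf scaleR_sum_right scaleR_diff_left)
    also have "norm \<dots> \<le> (\<Sum>c\<in>C. \<Sum>i\<in>I c. \<epsilon> * w A i * \<mu>)"
    proof (intro sum_norm_le)
      fix c i assume "c \<in> C" and i: "i \<in> I c"
      have "\<bar>\<phi> A i f - S c * (w A i / sum (w A) (I c))\<bar> \<le> \<epsilon> * w A i"
        unfolding S_def
      proof (rule cell_average_error[OF I i w0])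
        fix k assume "k \<in> I c"
        then have "label A k = c" by (simp add: I_def)
        then show "\<epsilon> * real_of_int (c f) * w A k \<le> \<phi> A k f"
            "\<phi> A k f \<le> (\<epsilon> * real_of_int (c f) + \<epsilon>) * w A k"
          using floor_bounds[OF f, where A = A and i = k] by simp_all
      qed
      moreover have "norm (g A i) \<le> \<mu>" using frame_vector[OF A(1)] i by (simp add: I_def)
      ultimately show "norm ((\<phi> A i f - S c * (w A i / sum (w A) (I c))) *\<^sub>R g A i) \<le> \<epsilon> * w A i * \<mu>"
        using \<epsilon>(1) w0[of A i] by (simp only: norm_scaleR real_norm_def) (intro mult_mono, auto)
    qed
    also have "\<dots> = \<epsilon> * \<mu> * (\<Sum>i<n A. w A i)"
      unfolding group by (simp add: sum_distrib_left mult_ac)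
    also have "(\<Sum>i<n A. w A i) = (\<Sum>f\<in>B. \<Sum>i<n A. \<bar>\<phi> A i f\<bar>)"
      unfolding w_def by (rule sum.swap)
    also have "\<epsilon> * \<mu> * \<dots> \<le> \<epsilon> * \<mu> * N"
      unfolding N_def using \<epsilon>(1) \<mu>_nonneg A
      by (intro mult_left_mono sum_mono frame_norm) (auto intro: span_base)
    also have "\<dots> \<le> \<delta> / 2" using \<epsilon>(2) by (simp add: mult.assoc)
    finally have 1: "norm (f - (\<Sum>c\<in>C. S c *\<^sub>R b c)) \<le> \<delta> / 2" .
    have "norm (\<Sum>c\<in>C. (S c - s c f) *\<^sub>R b c) \<le> (\<Sum>c\<in>C. \<bar>S c - s c f\<bar>) * \<mu>"
      by (rule norm_sum_scaleR_le) (rule b\<mu>)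
    also have "\<dots> \<le> (\<Sum>c\<in>C. \<eta>) * \<mu>"
      using close[OF f] \<mu>_nonneg unfolding S by (intro mult_right_mono sum_mono) (auto intro: less_imp_le)
    also have "\<dots> \<le> \<delta> / 2" using \<eta>(2) by simp
    finally have 2: "norm (\<Sum>c\<in>C. (S c - s c f) *\<^sub>R b c) \<le> \<delta> / 2" .
    have "f - (\<Sum>c\<in>C. s c f *\<^sub>R b c) =
        (f - (\<Sum>c\<in>C. S c *\<^sub>R b c)) + (\<Sum>c\<in>C. (S c - s c f) *\<^sub>R b c)"
      by (simp add: scaleR_diff_left sum_subtractf)
    also have "norm \<dots> \<le> \<delta>" by (rule norm_triangle_le) (use 1 2 in linarith)
    finally show ?thesis .
  qed
  from that[OF C s(1) s(2)[unfolded mult_1_left] b\<mu> this] show thesis .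
qed

text \<open>An approximate identity that moves the vectors of \<open>span B\<close> by at most half of their norm is
  injective there. Composing it with a linear left inverse gives a projection, and this is
  bounded, whatever the left inverse, since only finitely many values of it enter.\<close>

lemma bounded_projection_onto_span:
  fixes B :: "'a set"
  assumes B: "finite B" "independent B"
  obtains R where "bounded_linear R" "range R \<subseteq> span B" "\<And>x. x \<in> span B \<Longrightarrow> R x = x"
proof -
  obtain K where K: "K > 0" "\<And>c. (\<Sum>b\<in>B. \<bar>c b\<bar>) \<le> K * norm (\<Sum>b\<in>B. c b *\<^sub>R b)"
    using coefficients_bounded_by_norm[OF B] by metis
  have pos: "1 / (2 * K) > 0" using K by simp
  obtain C :: "('a \<Rightarrow> int) set" and s b
    where C: "finite C" and s: "\<And>c. c \<in> C \<Longrightarrow> bounded_linear (s c)"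
      and "\<And>x. (\<Sum>c\<in>C. \<bar>s c x\<bar>) \<le> norm x" "\<And>c. c \<in> C \<Longrightarrow> norm (b c) \<le> \<mu>"
      and dev: "\<And>f. f \<in> B \<Longrightarrow> norm (f - (\<Sum>c\<in>C. s c f *\<^sub>R b c)) \<le> 1 / (2 * K)"
    by (rule approximate_identity[OF B(1) pos]) (rule that)
  define P where "P x = (\<Sum>c\<in>C. s c x *\<^sub>R b c)" for x
  have P: "bounded_linear P" unfolding P_def by (rule finite_rank_sum[OF C s])
  interpret P: bounded_linear P by (rule P)
  have half: "norm (x - P x) \<le> norm x / 2" if "x \<in> span B" for x
    using deviation_on_span[OF B(1) P K(2), of "1 / (2 * K)" x] dev K(1) that by (simp add: P_def)
  have "inj_on P (span B)"
  proof (rule inj_onI)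
    fix x y assume xy: "x \<in> span B" "y \<in> span B" "P x = P y"
    then have "norm (x - y) \<le> norm (x - y) / 2"
      using half[of "x - y"] by (simp add: span_diff P.diff)
    then show "x = y" by simp
  qed
  then obtain h where h: "range h \<subseteq> span B" "linear h" "\<And>x. x \<in> span B \<Longrightarrow> h (P x) = x"
    using linear_exists_left_inverse_on[OF P.linear subspace_span] by blast
  have hP: "(\<lambda>x. h (P x)) = (\<lambda>x. \<Sum>c\<in>C. s c x *\<^sub>R h (b c))"
    by (simp add: P_def linear_sum[OF h(2)] linear_cmul[OF h(2)])
  show thesis
  proof (rule that)
    show "bounded_linear (\<lambda>x. h (P x))" unfolding hP by (rule finite_rank_sum[OF C s])
    show "range (\<lambda>x. h (P x)) \<subseteq> span B" using h(1) by blast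
  qed (rule h(3))
qed

text \<open>An approximate identity \<open>P\<close> near \<open>E\<close> has norm at most \<open>\<mu>\<close>, but only \<open>P x \<approx> x\<close> on \<open>E\<close>. With a
  bounded projection \<open>R\<close> onto \<open>E\<close>, the operator \<open>R + P (1 - R)\<close> equals \<open>P + (1 - P) R\<close>: it fixes
  \<open>E\<close>, and \<open>(1 - P) R\<close> is small when the error of \<open>P\<close> is chosen after \<open>R\<close>, however large the norm
  of \<open>R\<close> is.\<close>

lemma uniform_finite_rank_extension_of_identity:
  fixes E :: "'a set"
  assumes "finite_dim E"
  obtains P where "bounded_linear P" "finite_dim (range P)"
    "\<And>x. norm (P x) \<le> (\<mu> + 1) * norm x" "\<And>f. f \<in> E \<Longrightarrow> P f = f"
proof -
  obtain B where B: "finite B" "independent B" "E = span B"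
    using finite_dim_basis[OF assms] by metis
  obtain K where K: "K > 0" "\<And>c. (\<Sum>b\<in>B. \<bar>c b\<bar>) \<le> K * norm (\<Sum>b\<in>B. c b *\<^sub>R b)"
    using coefficients_bounded_by_norm[OF B(1,2)] by metis
  obtain R where R: "bounded_linear R" "range R \<subseteq> span B" "\<And>x. x \<in> span B \<Longrightarrow> R x = x"
    using bounded_projection_onto_span[OF B(1,2)] by metis
  interpret R: bounded_linear R by (rule R)
  obtain \<kappa> where \<kappa>: "\<kappa> > 0" "\<And>x. norm (R x) \<le> norm x * \<kappa>" using R.pos_bounded by blast
  have pos: "1 / (K * \<kappa>) > 0" using K \<kappa> by simp
  obtain C :: "('a \<Rightarrow> int) set" and s b
    where C: "finite C" and s: "\<And>c. c \<in> C \<Longrightarrow> bounded_linear (s c)"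
      and s1: "\<And>x. (\<Sum>c\<in>C. \<bar>s c x\<bar>) \<le> norm x" and b: "\<And>c. c \<in> C \<Longrightarrow> norm (b c) \<le> \<mu>"
      and dev: "\<And>f. f \<in> B \<Longrightarrow> norm (f - (\<Sum>c\<in>C. s c f *\<^sub>R b c)) \<le> 1 / (K * \<kappa>)"
    by (rule approximate_identity[OF B(1) pos]) (rule that)
  define P where "P x = (\<Sum>c\<in>C. s c x *\<^sub>R b c)" for x
  have P: "bounded_linear P" "finite_dim (range P)"
    unfolding P_def by (rule finite_rank_sum[OF C s]; assumption)+
  interpret P: bounded_linear P by (rule P)
  have P\<mu>: "norm (P x) \<le> \<mu> * norm x" for x
  proof -
    have "norm (P x) \<le> (\<Sum>c\<in>C. \<bar>s c x\<bar>) * \<mu>" unfolding P_def by (rule norm_sum_scaleR_le[OF b])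
    also have "\<dots> \<le> norm x * \<mu>" using s1 \<mu>_nonneg by (simp add: mult_right_mono)
    finally show ?thesis by (simp add: mult.commute)
  qed
  have "finite_dim (range R)"
    by (rule finite_dim_subspace[OF _ B(1) R(2)])
       (simp add: linear_subspace_image R.linear subspace_UNIV)
  note T = finite_rank_combine[OF R(1) this P]
  show thesis
  proof (rule that[OF T])
    fix x
    have "norm (R x - P (R x)) \<le> 1 / (K * \<kappa>) * K * norm (R x)"
      by (rule deviation_on_span[OF B(1) P(1) K(2)]) (use dev K \<kappa> R(2) in \<open>auto simp: P_def\<close>)
    also have "\<dots> \<le> norm x" using \<kappa> K(1) by (simp add: divide_simps)
    finally have "norm (P x + (R x - P (R x))) \<le> \<mu> * norm x + norm x"
      using P\<mu>[of x] by (intro norm_triangle_le) simp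
    then show "norm (R x + P (x - R x)) \<le> (\<mu> + 1) * norm x"
      by (simp add: P.diff algebra_simps)
  next
    fix f assume "f \<in> E"
    then show "R f + P (f - R f) = f" using R(3) B(3) P.zero by simp
  qed
qed

end

section \<open>Lifting of finite-rank operators\<close>

context ell1_frames
begin

text \<open>Each \<open>V (g A i)\<close> is a combination of atoms of the image of \<open>V\<close>, with controlled coefficients.
  The limit of these coefficients factors \<open>V\<close> through the \<open>\<ell>\<^sub>1\<close> over the atoms, and from there an
  operator lifts through \<open>q\<close> by lifting the finitely many atoms.\<close>

lemma finite_rank_lifting:
  fixes V :: "'a \<Rightarrow> 'x::real_normed_vector" and q :: "'e::real_normed_vector \<Rightarrow> 'x"
  assumes V: "bounded_linear V" "finite_dim (range V)" "\<And>x. norm (V x) \<le> v * norm x" "v \<ge> 0"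
    and q: "linear q" "\<And>y. \<exists>e. q e = y \<and> norm e \<le> \<theta> * norm y" "\<theta> \<ge> 0"
  obtains W where "bounded_linear W" "finite_dim (range W)" "\<And>x. q (W x) = V x"
    "\<And>x. norm (W x) \<le> 4 * \<mu> * \<theta> * v * norm x"
proof -
  interpret V: bounded_linear V by (rule V)
  obtain B where B: "finite B" "independent B" "range V = span B"
    using finite_dim_basis[OF V(2)] by metis
  obtain C t where C: "finite C" "\<And>c. c \<in> C \<Longrightarrow> norm c \<le> 2"
    and t: "\<And>x. x \<in> range V \<Longrightarrow> (\<Sum>c\<in>C. t x c *\<^sub>R c) = x"
      "\<And>x. x \<in> range V \<Longrightarrow> (\<Sum>c\<in>C. \<bar>t x c\<bar>) \<le> 2 * norm x"
    by (rule finite_dim_atoms[OF B(1,2), folded B(3)]) (rule that)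
  \<comment> \<open>The factor 2 is the bound on the coefficients of the atoms; their norms contribute another 2 to the constant of the lifting.\<close>
  define K where "K = 2 * (v * \<mu>)"
  have K: "K \<ge> 0" using V(4) \<mu>_nonneg by (simp add: K_def)
  have \<tau>: "(\<Sum>c\<in>C. \<bar>t (V (g A i)) c\<bar>) \<le> K" if "finite A" "i < n A" for A i
  proof -
    have "(\<Sum>c\<in>C. \<bar>t (V (g A i)) c\<bar>) \<le> 2 * norm (V (g A i))" by (rule t(2)) simp
    also have "\<dots> \<le> 2 * (v * norm (g A i))" using V(3) by simp
    also have "\<dots> \<le> K" unfolding K_def using frame_vector[OF that] V(4) by (simp add: mult_left_mono)
    finally show ?thesis .
  qed
  obtain F s where F: "F \<le> finite_subsets_at_top UNIV" "F \<noteq> bot"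
    and lim: "\<And>x c. c \<in> C \<Longrightarrow> ((\<lambda>A. \<Sum>i<n A. \<phi> A i x * t (V (g A i)) c) \<longlongrightarrow> s c x) F"
    and s: "\<And>c. c \<in> C \<Longrightarrow> bounded_linear (s c)" "\<And>x. (\<Sum>c\<in>C. \<bar>s c x\<bar>) \<le> K * norm x"
    by (rule coordinate_limit[where \<tau> = "\<lambda>A i. t (V (g A i))", OF C(1) K \<tau>]) (assumption+, rule that)
  have rep: "(\<Sum>c\<in>C. s c x *\<^sub>R c) = V x" for x
  proof (rule tendsto_unique[OF F(2)])
    show "((\<lambda>A. \<Sum>c\<in>C. (\<Sum>i<n A. \<phi> A i x * t (V (g A i)) c) *\<^sub>R c) \<longlongrightarrow> (\<Sum>c\<in>C. s c x *\<^sub>R c)) F"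
      by (intro tendsto_sum tendsto_scaleR lim tendsto_const)
    have "eventually (\<lambda>A. finite A \<and> {x} \<subseteq> A) F"
      by (rule filter_leD[OF F(1)]) (auto simp: eventually_finite_subsets_at_top)
    then have "eventually (\<lambda>A. V x = (\<Sum>c\<in>C. (\<Sum>i<n A. \<phi> A i x * t (V (g A i)) c) *\<^sub>R c)) F"
    proof eventually_elim
      case (elim A)
      have "(\<Sum>c\<in>C. (\<Sum>i<n A. \<phi> A i x * t (V (g A i)) c) *\<^sub>R c) =
          (\<Sum>i<n A. \<phi> A i x *\<^sub>R (\<Sum>c\<in>C. t (V (g A i)) c *\<^sub>R c))"
        by (simp add: scaleR_sum_left scaleR_sum_right) (rule sum.swap)
      also have "\<dots> = V (\<Sum>i<n A. \<phi> A i x *\<^sub>R g A i)"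
        by (simp add: t(1) V.sum V.scaleR)
      also have "\<dots> = V x" using frame_expand[of A x] elim by (simp add: span_base)
      finally show ?case by simp
    qed
    then show "((\<lambda>A. \<Sum>c\<in>C. (\<Sum>i<n A. \<phi> A i x * t (V (g A i)) c) *\<^sub>R c) \<longlongrightarrow> V x) F"
      by (rule Lim_transform_eventually[OF tendsto_const])
  qed
  obtain l where l: "\<And>y. q (l y) = y" "\<And>y. norm (l y) \<le> \<theta> * norm y" using q(2) by metis
  define W where "W x = (\<Sum>c\<in>C. s c x *\<^sub>R l c)" for x
  show thesis
  proof (rule that)
    show "bounded_linear W" "finite_dim (range W)"
      unfolding W_def by (rule finite_rank_sum[OF C(1) s(1)]; assumption)+
    show "q (W x) = V x" for x
      by (simp add: W_def linear_sum[OF q(1)] linear_cmul[OF q(1)] l(1) rep)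
    show "norm (W x) \<le> 4 * \<mu> * \<theta> * v * norm x" for x
    proof -
      have "norm (l c) \<le> \<theta> * 2" if "c \<in> C" for c
        using l(2)[of c] mult_left_mono[OF C(2)[OF that] q(3)] by linarith
      then have "norm (W x) \<le> (\<Sum>c\<in>C. \<bar>s c x\<bar>) * (\<theta> * 2)"
        unfolding W_def by (rule norm_sum_scaleR_le)
      also have "\<dots> \<le> (K * norm x) * (\<theta> * 2)" using s(2) q(3) by (intro mult_right_mono) auto
      finally show ?thesis by (simp add: K_def mult_ac)
    qed
  qed
qed

end

section \<open>Kernels of quotient maps\<close>

theorem theorem2p1:
  fixes j :: "'y::banach \<Rightarrow> 'l::banach" and q :: "'l \<Rightarrow> 'x::banach"
  assumes "is_L1_space TYPE('l)"
    and "short_exact_sequence j q"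
    and "has_BAP TYPE('x)"
  shows "has_BAP TYPE('y)"
proof -
  obtain \<mu> n \<phi> and g :: "'l set \<Rightarrow> nat \<Rightarrow> 'l" where frames: "ell1_frames \<mu> n \<phi> g"
    using L1_space_ell1_frames[OF assms(1)] by metis
  interpret ell1_frames \<mu> n \<phi> g by (rule frames)
  have j: "bounded_linear j" and q: "bounded_linear q" and inj0: "{y. j y = 0} = {0}"
    and ker: "{e. q e = 0} = range j" and surj: "range q = UNIV"
    using assms(2) unfolding short_exact_sequence_def by auto
  interpret j: bounded_linear j by (rule j)
  interpret q: bounded_linear q by (rule q)
  have "inj j" unfolding linear_injective_0[OF j.linear] using inj0 by blast
  \<comment> \<open>\<open>h\<close> inverts \<open>j\<close>; off the range of \<open>j\<close> its values are arbitrary and need not be bounded.\<close>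
  obtain h where h: "linear h" "\<And>y. h (j y) = y"
    using linear_injective_left_inverse[OF j.linear \<open>inj j\<close>] by (metis comp_apply id_apply)
  have qj: "q (j y) = 0" for y using ker by blast
  have "closed (range j)"
    unfolding ker[symmetric] by (intro closed_Collect_eq linear_continuous_on q continuous_on_const)
  then obtain \<beta> where \<beta>: "\<beta> > 0" "\<And>e. e \<in> range j \<Longrightarrow> \<exists>y. j y = e \<and> norm y \<le> \<beta> * norm e"
    using open_mapping_closed_range[OF j] by metis
  have hb: "norm (h e) \<le> \<beta> * norm e" if "q e = 0" for e
  proof -
    have "e \<in> range j" using that ker by blast
    then obtain y where "j y = e" "norm y \<le> \<beta> * norm e" using \<beta>(2) by blast
    then show ?thesis using h(2)[of y] by simp
  qed
  obtain \<theta> where \<theta>: "\<theta> > 0" "\<And>x. \<exists>e. q e = x \<and> norm e \<le> \<theta> * norm x"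
    using open_mapping_closed_range[OF q] by (metis UNIV_I closed_UNIV surj)
  obtain \<rho> where \<rho>: "\<rho> \<ge> 1" "has_lambda_BAP \<rho> TYPE('x)"
    using assms(3) unfolding has_BAP_def by blast
  obtain a where a: "a > 0" "\<And>y. norm (j y) \<le> norm y * a" using j.pos_bounded by blast
  obtain d where d: "d > 0" "\<And>e. norm (q e) \<le> norm e * d" using q.pos_bounded by blast
  define p where "p = \<mu> + 1"
  define w where "w = 4 * \<mu> * \<theta> * (\<rho> * d)"
  define \<Lambda> where "\<Lambda> = \<beta> * (p + w * (1 + p)) * a"
  have pw: "p \<ge> 0" "w \<ge> 0" using \<mu>_nonneg \<theta>(1) \<rho>(1) d(1) by (simp_all add: p_def w_def)
  have "has_lambda_BAP (max 1 \<Lambda>) TYPE('y)"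
    unfolding has_lambda_BAP_def
  proof (intro allI impI)
    fix E :: "'y set" assume E: "finite_dim E"
    obtain P where P: "bounded_linear P" "finite_dim (range P)" "\<And>x. norm (P x) \<le> p * norm x"
        "\<And>f. f \<in> j ` E \<Longrightarrow> P f = f"
      by (rule uniform_finite_rank_extension_of_identity
            [OF finite_dim_linear_image[OF j.linear E], folded p_def]) (rule that)
    interpret P: bounded_linear P by (rule P)
    obtain S where S: "bounded_linear S" "finite_dim (range S)" "onorm S \<le> \<rho>"
        "\<And>x. x \<in> q ` range P \<Longrightarrow> S x = x"
      using \<rho>(2) finite_dim_linear_image[OF q.linear P(2)] unfolding has_lambda_BAP_def by metis
    have SV: "norm (S (q x)) \<le> \<rho> * d * norm x" for x
    proof -
      have "norm (S (q x)) \<le> onorm S * norm (q x)" by (rule onorm[OF S(1)])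
      also have "\<dots> \<le> \<rho> * (norm x * d)" using S(3) \<rho>(1) d(2) by (intro mult_mono) auto
      finally show ?thesis by (simp add: mult_ac)
    qed
    have "range (\<lambda>x. S (q x)) = range S" using surj by (metis image_image)
    then have fV: "finite_dim (range (\<lambda>x. S (q x)))" using S(2) by simp
    have bV: "bounded_linear (\<lambda>x. S (q x))" by (rule bounded_linear_compose[OF S(1) q])
    have pos: "\<rho> * d \<ge> 0" "\<theta> \<ge> 0" using \<rho>(1) d(1) \<theta>(1) by simp_all
    obtain W where W: "bounded_linear W" "finite_dim (range W)" "\<And>x. q (W x) = S (q x)"
        "\<And>x. norm (W x) \<le> w * norm x"
      by (rule finite_rank_lifting[OF bV fV SV pos(1) q.linear \<theta>(2) pos(2), folded w_def]) (rule that)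
    interpret W: bounded_linear W by (rule W)
    define T where "T x = P x + W (x - P x)" for x
    have T: "bounded_linear T" "finite_dim (range T)"
      unfolding T_def by (rule finite_rank_combine[OF P(1,2) W(1,2)])+
    interpret T: bounded_linear T by (rule T)
    \<comment> \<open>\<open>S\<close> fixes \<open>q (P (j y))\<close>, and \<open>q (j y) = 0\<close>.\<close>
    have qT: "q (T (j y)) = 0" for y
      using S(4)[of "q (P (j y))"] by (simp add: T_def q.add q.diff W.diff W(3) qj bounded_linear.linear[OF S(1)] linear_0)
    have Tw: "norm (T x) \<le> (p + w * (1 + p)) * norm x" for x
    proof -
      have "norm (x - P x) \<le> (1 + p) * norm x"
        using norm_triangle_ineq4[of x "P x"] P(3)[of x] by (simp add: distrib_right)
      then have "w * norm (x - P x) \<le> w * ((1 + p) * norm x)" using pw by (simp add: mult_left_mono)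
      then have "norm (T x) \<le> p * norm x + w * ((1 + p) * norm x)"
        unfolding T_def using P(3)[of x] W(4)[of "x - P x"] by (intro norm_triangle_le) linarith
      then show ?thesis by (simp add: distrib_right mult.assoc)
    qed
    define U where "U y = h (T (j y))" for y
    have Ub: "norm (U y) \<le> \<Lambda> * norm y" for y
    proof -
      have "norm (U y) \<le> \<beta> * norm (T (j y))" unfolding U_def by (rule hb[OF qT])
      also have "\<dots> \<le> \<beta> * ((p + w * (1 + p)) * norm (j y))" using Tw \<beta>(1) by simp
      also have "\<dots> \<le> \<beta> * ((p + w * (1 + p)) * (norm y * a))"
        using a(2) \<beta>(1) pw by (intro mult_left_mono) auto
      finally show ?thesis by (simp add: \<Lambda>_def mult_ac)
    qed
    have linU: "linear U"
      unfolding U_def using linear_compose[OF linear_compose[OF j.linear T.linear] h(1)]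
      by (simp add: o_def)
    show "\<exists>T. bounded_linear T \<and> finite_dim (range T) \<and> onorm T \<le> max 1 \<Lambda> \<and> (\<forall>f\<in>E. T f = f)"
    proof (intro exI conjI ballI)
      show "bounded_linear U"
        by (rule bounded_linear_intro[where K = \<Lambda>])
           (use Ub in \<open>simp_all add: linear_add[OF linU] linear_cmul[OF linU] mult.commute\<close>)
      obtain A where A: "finite A" "range T = span A" using T(2) unfolding finite_dim_def by blast
      show "finite_dim (range U)"
      proof (rule finite_dim_subspace)
        show "subspace (range U)" by (simp add: linear_subspace_image linU subspace_UNIV)
        show "finite (h ` A)" using A by simp
        have "h ` range T = span (h ` A)" unfolding A(2) by (rule linear_span_image[OF h(1), symmetric])
        then show "range U \<subseteq> span (h ` A)" unfolding U_def by blast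
      qed
      show "onorm U \<le> max 1 \<Lambda>"
      proof (rule onorm_bound)
        show "0 \<le> max 1 \<Lambda>" by simp
        fix y show "norm (U y) \<le> max 1 \<Lambda> * norm y"
          using Ub[of y] mult_right_mono[OF max.cobounded2[of \<Lambda> 1] norm_ge_zero[of y]] by linarith
      qed
      fix f assume "f \<in> E"
      then have "P (j f) = j f" using P(4) by blast
      then show "U f = f" by (simp add: U_def T_def W.zero h(2))
    qed
  qed
  then show ?thesis unfolding has_BAP_def by (intro exI[of _ "max 1 \<Lambda>"]) simp
qed

end
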